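(* If $f\in L^2(\mathbb R^n)$ is non-zero and log-concave, then \[\frac1{\Gamma(\beta+1)^{1/\beta}}\,\mathrm{R}_\beta f\subseteq\frac1{\Gamma(\alpha+1)^{1/\alpha}}\,\mathrm{R}_\alpha f\] for all $-1<\alpha<\beta<\infty$ (where for the index $0$ the factor $\Gamma(\alpha+1)^{1/\alpha}$ is interpreted as its limit $e^{-\gamma}$, $\gamma$ Euler's constant). There is equality if $f(x)=a\,e^{-\Vert x-x_0\Vert_\Delta}$ for $x\in\mathbb R^n$, with $a>0$, $x_0\in\mathbb R^n$ and $\Delta$ an $n$-dimensional simplex having a vertex at the origin.
   Context: Star-shaped sets are described by radial functions $\rho_K$ on $\mathbb S^{n-1}$; $\lambda K$ has radial function $\lambda\rho_K$, and $K\subseteq L$ means $\rho_K\le\rho_L$. $\Vert x\Vert_\Delta=\inf\{\lambda>0:x\in\lambda\Delta\}$. For non-negative non-zero $f\in L^2(\mathbb R^n)$: for $\alpha>0$, $\mathrm{R}_\alpha f$ is the star-shaped set with $\rho_{\mathrm{R}_\alpha f}(\xi)^\alpha=\frac{\alpha}{\Vert f\Vert_2^2}\int_0^\infty t^{\alpha-1}\int_{\mathbb R^n}f(x)f(x+t\xi)\,dx\,dt$; for $-1<\alpha<0$, $\mathrm{R}_\alpha f$ is the star-shaped set with $\rho_{\mathrm{R}_\alpha f}(\xi)^\alpha=\frac{|\alpha|}{2\Vert f\Vert_2^2}\int_0^\infty t^{\alpha-1}\int_{\mathbb R^n}|f(x+t\xi)-f(x)|^2\,dx\,dt$; and $\log\rho_{\mathrm{R}_0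 f}(\xi)=-\gamma+\int_0^\infty\frac1t\big(\frac1{\Vert f\Vert_2^2}\int_{\mathbb R^n}f(x)f(x+t\xi)\,dx-e^{-t}\big)\,dt$, with $\gamma$ Euler's constant. A log-concave function is one whose logarithm is concave with values in $[-\infty,\infty)$. *)

theory Defs
  imports "HOL-Analysis.Analysis"
begin

definition l2sq :: "('a::euclidean_space \<Rightarrow> real) \<Rightarrow> real" where
  "l2sq f = (LINT x|lebesgue. (f x)\<^sup>2)"

definition in_L2 :: "('a::euclidean_space \<Rightarrow> real) \<Rightarrow> bool" where
  "in_L2 f \<longleftrightarrow> f \<in> borel_measurable lebesgue \<and> integrable lebesgue (\<lambda>x. (f x)\<^sup>2)"

text \<open>Log-concave: f = exp o phi with phi concave with values in [-inf,inf).
  Equivalently: f \<ge> 0, the set where phi > -inf (i.e. f > 0) is convex and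
  ln f is concave there.\<close>
definition log_concave :: "('a::euclidean_space \<Rightarrow> real) \<Rightarrow> bool" where
  "log_concave f \<longleftrightarrow> (\<forall>x. 0 \<le> f x) \<and> convex {x. 0 < f x} \<and>
     concave_on {x. 0 < f x} (\<lambda>x. ln (f x))"

definition covar :: "('a::euclidean_space \<Rightarrow> real) \<Rightarrow> 'a \<Rightarrow> real" where
  "covar f y = (LINT x|lebesgue. f x * f (x + y))"

text \<open>Radial function of the radial mean body R_alpha f, evaluated at xi
  (meaningful for alpha > -1 and xi on the unit sphere).\<close>
definition radial_mean_rho :: "real \<Rightarrow> ('a::euclidean_space \<Rightarrow> real) \<Rightarrow> 'a \<Rightarrow> real" where
  "radial_mean_rho \<alpha> f \<xi> =
    (if 0 < \<alpha> then
       (\<alpha> / l2sq f * (LINT t:{0<..}|lborel. t powr (\<alpha> - 1) * covar f (t *\<^sub>R \<xi>))) powr (1 / \<alpha>)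
     else if \<alpha> < 0 then
       (\<bar>\<alpha>\<bar> / (2 * l2sq f) * (LINT t:{0<..}|lborel.
           t powr (\<alpha> - 1) * (LINT x|lebesgue. (f (x + t *\<^sub>R \<xi>) - f x)\<^sup>2))) powr (1 / \<alpha>)
     else
       exp (- euler_mascheroni + (LINT t:{0<..}|lborel.
           (1 / t) * (covar f (t *\<^sub>R \<xi>) / l2sq f - exp (- t)))))"

text \<open>Normalizing factor Gamma(alpha+1)^(1/alpha), with its limit exp(-gamma) at alpha = 0.\<close>
definition gamma_factor :: "real \<Rightarrow> real" where
  "gamma_factor \<alpha> = (if \<alpha> = 0 then exp (- euler_mascheroni) else Gamma (\<alpha> + 1) powr (1 / \<alpha>))"

text \<open>Gauge (Minkowski functional) inf {lambda > 0. x \<in> lambda Delta}, with inf of empty set = +infinity.\<close>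
definition gauge :: "'a::euclidean_space set \<Rightarrow> 'a \<Rightarrow> ereal" where
  "gauge \<Delta> x = Inf {ereal r | r. r > 0 \<and> x \<in> (\<lambda>y. r *\<^sub>R y) ` \<Delta>}"

text \<open>The function a * exp(- ||x - x0||_Delta), with exp(-infinity) = 0.\<close>
definition simplex_exp :: "real \<Rightarrow> 'a::euclidean_space \<Rightarrow> 'a set \<Rightarrow> 'a \<Rightarrow> real" where
  "simplex_exp a x0 \<Delta> x =
     (if gauge \<Delta> (x - x0) = \<infinity> then 0 else a * exp (- real_of_ereal (gauge \<Delta> (x - x0))))"

definition full_simplex_vertex0 :: "'a::euclidean_space set \<Rightarrow> bool" where
  "full_simplex_vertex0 \<Delta> \<longleftrightarrow>
     (\<exists>C. \<not> affine_dependent C \<and> card C = DIM('a) + 1 \<and> 0 \<in> C \<and> \<Delta> = convex hull C)"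

end

theory Submission
  imports Defs
begin

text \<open>
  Fix a direction \<open>\<xi>\<close> and put \<open>g t = covar f (t *\<^sub>R \<xi>) / l2sq f\<close>, so that \<open>g \<le> 1 = g 0\<close>. By the
  Prekopa-Leindler inequality \<open>covar f\<close> inherits log-concavity from \<open>f\<close>, so \<open>g t powr (s / t) \<le> g s\<close> for
  \<open>0 < s \<le> t\<close>, and therefore \<open>g\<close> crosses every exponential \<open>exp (- k t)\<close> at most once, from above to below.
  All normalized mean radii of this exponential equal \<open>1 / k\<close>, and the normalized \<open>\<alpha>\<close>-radius of \<open>g\<close> is at
  most \<open>1 / k\<close> exactly when \<open>\<integral> t powr (\<alpha> - 1) * (g t - exp (- k t)) dt \<le> 0\<close>. Choosing for \<open>1 / k\<close> the
  normalized \<open>\<alpha>\<close>-radius itself, the single crossing carries this inequality over to every \<open>\<beta> > \<alpha>\<close>.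

  For \<open>f x = a exp (- gauge \<Delta> (x - x0))\<close> the coordinates with respect to the nonzero vertices of \<open>\<Delta>\<close>
  split \<open>f\<close> into one-dimensional factors, and the product of \<open>f\<close> with a translate is a multiple of
  a translate of the square of \<open>f\<close>. Hence \<open>g\<close> itself is an exponential.
\<close>

section \<open>The Prekopa-Leindler inequality\<close>

lemma emeasure_lborel_vimage_translate:
  fixes A :: "'a::euclidean_space set"
  assumes "A \<in> sets borel"
  shows "emeasure lborel {z. z - b \<in> A} = emeasure lborel A"
proof -
  have "emeasure lborel A = emeasure (distr lborel borel ((+) (- b))) A"
    by (simp add: lborel_distr_plus)
  also have "\<dots> = emeasure lborel {z. z - b \<in> A}"
    using assms by (subst emeasure_distr) (auto simp: vimage_def)
  finally show ?thesis ..
qed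

text \<open>The translates \<open>A + b\<close> and \<open>a + B\<close> with \<open>a\<close> close to \<open>Sup A\<close> and \<open>b\<close> close to \<open>Inf B\<close>
  overlap only in a short interval, which avoids any appeal to compactness.\<close>

lemma brunn_minkowski_real_bounded:
  fixes A B C :: "real set"
  assumes [measurable]: "A \<in> sets borel" "B \<in> sets borel" "C \<in> sets borel"
    and nonempty: "A \<noteq> {}" "B \<noteq> {}" and bdd: "bdd_above A" "bdd_below B"
    and sumset: "\<And>x y. x \<in> A \<Longrightarrow> y \<in> B \<Longrightarrow> x + y \<in> C"
  shows "emeasure lborel A + emeasure lborel B \<le> emeasure lborel C"
proof (rule ennreal_le_epsilon)
  fix e :: real assume e_pos: "0 < e"
  obtain a where near_Sup: "a \<in> A" "Sup A - e / 2 < a"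
    using less_cSup_iff[OF nonempty(1) bdd(1), of "Sup A - e / 2"] e_pos by auto
  obtain b where near_Inf: "b \<in> B" "b < Inf B + e / 2"
    using cInf_less_iff[OF nonempty(2) bdd(2), of "Inf B + e / 2"] e_pos by auto
  define A_b where "A_b = {z. z - b \<in> A}"
  define a_B where "a_B = {z. z - a \<in> B}"
  have [measurable]: "A_b \<in> sets borel" "a_B \<in> sets borel"
    unfolding A_b_def a_B_def by measurable
  have "A_b \<inter> a_B \<subseteq> {a + Inf B .. Sup A + b}"
    using cSup_upper[OF _ bdd(1)] cInf_lower[OF _ bdd(2)] by (force simp: A_b_def a_B_def)
  then have "emeasure lborel (A_b \<inter> a_B) \<le> emeasure lborel {a + Inf B .. Sup A + b}"
    by (intro emeasure_mono) auto
  also have "\<dots> = ennreal (Sup A + b - (a + Inf B))"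
    using cSup_upper[OF near_Sup(1) bdd(1)] cInf_lower[OF near_Inf(1) bdd(2)]
    by (intro emeasure_lborel_Icc) simp
  also have "\<dots> \<le> ennreal e"
    using near_Sup(2) near_Inf(2) by (intro ennreal_leI) simp
  finally have overlap: "emeasure lborel (A_b \<inter> a_B) \<le> ennreal e" .
  have "A_b \<union> a_B \<subseteq> C"
    using sumset[OF _ near_Inf(1)] sumset[OF near_Sup(1)] by (force simp: A_b_def a_B_def)
  then have union: "emeasure lborel (A_b \<union> a_B) \<le> emeasure lborel C"
    by (intro emeasure_mono) auto
  have "emeasure lborel A + emeasure lborel B = emeasure lborel A_b + emeasure lborel a_B"
    by (simp add: A_b_def a_B_def emeasure_lborel_vimage_translate)
  also have "\<dots> = emeasure lborel (A_b \<union> a_B) + emeasure lborel (A_b \<inter> a_B)"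
    by (rule emeasure_Un_Int) auto
  also have "\<dots> \<le> emeasure lborel C + ennreal e"
    by (intro add_mono union overlap)
  finally show "emeasure lborel A + emeasure lborel B \<le> emeasure lborel C + ennreal e" .
qed

lemma brunn_minkowski_real:
  fixes A B C :: "real set"
  assumes [measurable]: "A \<in> sets borel" "B \<in> sets borel" "C \<in> sets borel"
    and nonempty: "A \<noteq> {}" "B \<noteq> {}"
    and sumset: "\<And>x y. x \<in> A \<Longrightarrow> y \<in> B \<Longrightarrow> x + y \<in> C"
  shows "emeasure lborel A + emeasure lborel B \<le> emeasure lborel C"
proof -
  obtain a b where mem: "a \<in> A" "b \<in> B" using nonempty by auto
  define A' where "A' n = A \<inter> {.. max a (real n)}" for n
  define B' where "B' n = B \<inter> {min b (- real n) ..}" for n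
  have [measurable]: "A' n \<in> sets borel" "B' n \<in> sets borel" for n
    unfolding A'_def B'_def by auto
  have Union_A': "(\<Union>n. A' n) = A"
    unfolding A'_def by (auto simp: le_max_iff_disj intro: real_arch_simple)
  have "\<exists>n. - x \<le> real n" for x by (rule real_arch_simple)
  then have Union_B': "(\<Union>n. B' n) = B"
    unfolding B'_def by (auto simp: min_le_iff_disj minus_le_iff)
  have bound: "emeasure lborel (A' n) + emeasure lborel (B' n) \<le> emeasure lborel C" for n
    using mem sumset unfolding A'_def B'_def
    by (intro brunn_minkowski_real_bounded) (auto intro: bdd_above_Int2 bdd_below_Int2)
  have "(\<lambda>n. emeasure lborel (A' n) + emeasure lborel (B' n))
      \<longlonglongrightarrow> emeasure lborel (\<Union>n. A' n) + emeasure lborel (\<Union>n. B' n)"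
  proof (intro tendsto_add Lim_emeasure_incseq)
    show "incseq A'" "incseq B'"
      unfolding A'_def B'_def by (auto simp: incseq_def le_max_iff_disj min_le_iff_disj)
  qed auto
  then show ?thesis
    unfolding Union_A' Union_B' by (rule LIMSEQ_le_const2) (use bound in auto)
qed

lemma emeasure_lborel_less_ennreal: "emeasure lborel {t. 0 < t \<and> ennreal t < p} = p"
proof (cases p)
  case (real r)
  then have "{t. 0 < t \<and> ennreal t < p} = {0<..<r}" by (auto simp: ennreal_less_iff)
  then show ?thesis using real by simp
next
  case top
  have "of_nat n \<le> emeasure lborel {0::real<..}" for n
  proof -
    have "of_nat n = emeasure lborel {0<..<real n}" by (simp add: ennreal_of_nat_eq_real_of_nat)
    also have "\<dots> \<le> emeasure lborel {0::real<..}" by (intro emeasure_mono) auto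
    finally show ?thesis .
  qed
  then have "(SUP n. of_nat n) \<le> emeasure lborel {0::real<..}" by (rule SUP_least)
  then show ?thesis using top by (simp add: ennreal_SUP_of_nat_eq_top top_unique greaterThan_def)
qed

lemma (in sigma_finite_measure) nn_integral_layer_cake:
  assumes [measurable]: "F \<in> borel_measurable M"
  shows "(\<integral>\<^sup>+x. F x \<partial>M)
    = (\<integral>\<^sup>+t. indicator {0<..} t * emeasure M {x \<in> space M. ennreal t < F x} \<partial>lborel)"
proof -
  interpret pair_sigma_finite lborel M ..
  have [measurable]: "{t. 0 < t \<and> ennreal t < p} \<in> sets borel" for p by measurable
  have "(\<integral>\<^sup>+x. F x \<partial>M) = (\<integral>\<^sup>+x. (\<integral>\<^sup>+t. indicator {t. 0 < t \<and> ennreal t < F x} t \<partial>lborel) \<partial>M)"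
    by (simp add: emeasure_lborel_less_ennreal)
  also have "\<dots>
      = (\<integral>\<^sup>+x. (\<integral>\<^sup>+t. indicator {0<..} t * indicator {x \<in> space M. ennreal t < F x} x \<partial>lborel) \<partial>M)"
    by (intro nn_integral_cong) (auto simp: indicator_def)
  also have "\<dots>
      = (\<integral>\<^sup>+t. (\<integral>\<^sup>+x. indicator {0<..} t * indicator {x \<in> space M. ennreal t < F x} x \<partial>M) \<partial>lborel)"
    by (rule Fubini') measurable
  also have "\<dots> = (\<integral>\<^sup>+t. indicator {0<..} t * emeasure M {x \<in> space M. ennreal t < F x} \<partial>lborel)"
    by (simp add: nn_integral_cmult)
  finally show ?thesis .
qed

lemma brunn_minkowski_real_functional:
  fixes F G H :: "real \<Rightarrow> ennreal"
  assumes [measurable]: "F \<in> borel_measurable borel" "G \<in> borel_measurable borel"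
      "H \<in> borel_measurable borel"
    and SUP_eq: "(SUP x. F x) = (SUP x. G x)"
    and min_le: "\<And>x y. min (F x) (G y) \<le> H (x + y)"
  shows "(\<integral>\<^sup>+x. F x \<partial>lborel) + (\<integral>\<^sup>+x. G x \<partial>lborel) \<le> (\<integral>\<^sup>+x. H x \<partial>lborel)"
proof -
  have level: "emeasure lborel {x. ennreal t < F x} + emeasure lborel {x. ennreal t < G x}
      \<le> emeasure lborel {x. ennreal t < H x}" for t
  proof (cases "ennreal t < (SUP x. F x)")
    case True
    then have "ennreal t < (SUP x. F x)" "ennreal t < (SUP x. G x)" by (simp_all flip: SUP_eq)
    then have "{x. ennreal t < F x} \<noteq> {}" "{x. ennreal t < G x} \<noteq> {}" by (auto simp: less_SUP_iff)
    moreover have "ennreal t < H (x + y)" if "ennreal t < F x" "ennreal t < G y" for x y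
      using that less_le_trans[OF _ min_le] by simp
    ultimately show ?thesis by (intro brunn_minkowski_real) auto
  next
    case False
    then have "\<not> ennreal t < (SUP x. F x)" "\<not> ennreal t < (SUP x. G x)" by (simp_all flip: SUP_eq)
    then have "{x. ennreal t < F x} = {}" "{x. ennreal t < G x} = {}" by (auto simp: less_SUP_iff)
    then show ?thesis by simp
  qed
  have "(\<integral>\<^sup>+x. F x \<partial>lborel) + (\<integral>\<^sup>+x. G x \<partial>lborel)
      = (\<integral>\<^sup>+t. indicator {0<..} t
          * (emeasure lborel {x. ennreal t < F x} + emeasure lborel {x. ennreal t < G x}) \<partial>lborel)"
    using lborel.nn_integral_layer_cake[of F] lborel.nn_integral_layer_cake[of G]
    by (simp add: distrib_left nn_integral_add)
  also have "\<dots> \<le> (\<integral>\<^sup>+t. indicator {0<..} t * emeasure lborel {x. ennreal t < H x} \<partial>lborel)"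
    by (intro nn_integral_mono mult_left_mono level) simp
  also have "\<dots> = (\<integral>\<^sup>+x. H x \<partial>lborel)"
    using lborel.nn_integral_layer_cake[of H] by simp
  finally show ?thesis .
qed

lemma brunn_minkowski_real_functional_weighted:
  fixes F G H :: "real \<Rightarrow> ennreal"
  assumes pq_pos: "0 < p" "0 < q"
    and [measurable]: "F \<in> borel_measurable borel" "G \<in> borel_measurable borel"
      "H \<in> borel_measurable borel"
    and SUP_eq: "(SUP x. F x) = (SUP x. G x)"
    and min_le: "\<And>x y. min (F x) (G y) \<le> H (p * x + q * y)"
  shows "ennreal p * (\<integral>\<^sup>+x. F x \<partial>lborel) + ennreal q * (\<integral>\<^sup>+x. G x \<partial>lborel) \<le> (\<integral>\<^sup>+x. H x \<partial>lborel)"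
proof -
  have SUP_dilate: "(SUP x. K (0 + 1 / c * x)) = (SUP x. K x)" if "0 < c"
    for K :: "real \<Rightarrow> ennreal" and c
  proof -
    have surj: "surj (\<lambda>x. 0 + 1 / c * x)" using that by (intro surjI[of _ "\<lambda>y. c * y"]) simp
    have "(SUP x. K (0 + 1 / c * x)) = Sup (K ` range (\<lambda>x. 0 + 1 / c * x))" by (simp only: image_image)
    then show ?thesis by (simp only: surj)
  qed
  have integral_dilate: "ennreal c * (\<integral>\<^sup>+x. K x \<partial>lborel) = (\<integral>\<^sup>+x. K (0 + 1 / c * x) \<partial>lborel)"
    if [measurable]: "K \<in> borel_measurable borel" and c_pos: "0 < c" for K c
  proof -
    have "(\<integral>\<^sup>+x. K x \<partial>lborel) = ennreal (1 / c) * (\<integral>\<^sup>+x. K (0 + 1 / c * x) \<partial>lborel)"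
      using nn_integral_real_affine[of K "1 / c" 0] c_pos by simp
    then show ?thesis using c_pos by (simp flip: ennreal_mult' mult.assoc)
  qed
  have "min (F (0 + 1 / p * x)) (G (0 + 1 / q * y)) \<le> H (x + y)" for x y
    using min_le[of "0 + 1 / p * x" "0 + 1 / q * y"] pq_pos by simp
  then show ?thesis
    unfolding integral_dilate[OF assms(3) pq_pos(1)] integral_dilate[OF assms(4) pq_pos(2)]
    by (intro brunn_minkowski_real_functional) (simp_all only: SUP_dilate pq_pos SUP_eq, measurable)
qed

text \<open>The value \<open>p\<^sup>1\<^sup>-\<^sup>l q\<^sup>l\<close> with the convention \<open>0 \<cdot> \<infinity> = 0\<close>. The strict inequalities make it
  compatible with suprema.\<close>

definition geometric_mean :: "real \<Rightarrow> ennreal \<Rightarrow> ennreal \<Rightarrow> ennreal" where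
  "geometric_mean l p q = (SUP (a, b) \<in> {(a, b). 0 < a \<and> 0 < b \<and> ennreal a < p \<and> ennreal b < q}.
     ennreal (a powr (1 - l) * b powr l))"

lemma geometric_mean_le_iff:
  "geometric_mean l p q \<le> r \<longleftrightarrow> (\<forall>a b. 0 < a \<and> 0 < b \<and> ennreal a < p \<and> ennreal b < q
     \<longrightarrow> ennreal (a powr (1 - l) * b powr l) \<le> r)"
  by (auto simp: geometric_mean_def SUP_le_iff)

lemma le_geometric_mean:
  "0 < a \<Longrightarrow> 0 < b \<Longrightarrow> ennreal a < p \<Longrightarrow> ennreal b < q
    \<Longrightarrow> ennreal (a powr (1 - l) * b powr l) \<le> geometric_mean l p q"
  using geometric_mean_le_iff[of l p q "geometric_mean l p q"] by simp

lemma geometric_mean_mono: "p \<le> p' \<Longrightarrow> q \<le> q' \<Longrightarrow> geometric_mean l p q \<le> geometric_mean l p' q'"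
  by (auto simp: geometric_mean_le_iff intro: le_geometric_mean)

lemma geometric_mean_0 [simp]: "geometric_mean l 0 q = 0" "geometric_mean l p 0 = 0"
  by (simp_all add: geometric_mean_le_iff flip: le_zero_eq)

lemma geometric_mean_SUP_le:
  assumes "\<And>m n. geometric_mean l (p m) (q n) \<le> r"
  shows "geometric_mean l (SUP m. p m) (SUP n. q n) \<le> r"
  using assms by (auto simp: geometric_mean_le_iff less_SUP_iff)

lemma min_le_geometric_mean: "min p q \<le> geometric_mean l p q"
proof (rule dense_le)
  fix r assume r_less: "r < min p q"
  show "r \<le> geometric_mean l p q"
  proof (cases r)
    case (real t)
    show ?thesis
    proof (cases "t = 0")
      case False
      then have "ennreal (t powr (1 - l) * t powr l) \<le> geometric_mean l p q"
        using real r_less by (intro le_geometric_mean) auto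
      then show ?thesis using real False by (simp flip: powr_add)
    qed (use real in simp)
  qed (use r_less in simp)
qed

lemma geometric_mean_le_arithmetic_mean:
  assumes weight: "0 < l" "l < 1"
  shows "geometric_mean l p q \<le> ennreal (1 - l) * p + ennreal l * q"
  unfolding geometric_mean_le_iff
proof (intro allI impI, elim conjE)
  fix a b :: real assume less: "0 < a" "0 < b" "ennreal a < p" "ennreal b < q"
  have "ennreal (a powr (1 - l) * b powr l) \<le> ennreal ((1 - l) * a + l * b)"
    using weight less by (intro ennreal_leI Youngs_inequality_0) auto
  also have "\<dots> = ennreal (1 - l) * ennreal a + ennreal l * ennreal b"
    using weight less by (simp add: ennreal_mult' ennreal_plus)
  also have "\<dots> \<le> ennreal (1 - l) * p + ennreal l * q"
    using less by (intro add_mono mult_left_mono) auto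
  finally show "ennreal (a powr (1 - l) * b powr l) \<le> ennreal (1 - l) * p + ennreal l * q" .
qed

lemma geometric_mean_cmult_le:
  assumes c_pos: "0 < c" and d_pos: "0 < d"
  shows "geometric_mean l (ennreal c * p) (ennreal d * q)
      \<le> ennreal (c powr (1 - l) * d powr l) * geometric_mean l p q"
  unfolding geometric_mean_le_iff
proof (intro allI impI, elim conjE)
  have divide_less: "ennreal (a / c) < p" if "0 < a" "ennreal a < ennreal c * p" "0 < c" for a c p
  proof (rule ccontr)
    assume "\<not> ennreal (a / c) < p"
    then have "ennreal c * p \<le> ennreal c * ennreal (a / c)" by (intro mult_left_mono) auto
    also have "\<dots> = ennreal a" using that by (simp flip: ennreal_mult')
    finally show False using that by simp
  qed
  fix a b :: real assume less: "0 < a" "0 < b" "ennreal a < ennreal c * p" "ennreal b < ennreal d * q"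
  have "ennreal (a powr (1 - l) * b powr l)
      = ennreal (c powr (1 - l) * d powr l) * ennreal ((a / c) powr (1 - l) * (b / d) powr l)"
    using c_pos d_pos by (simp add: powr_divide field_simps flip: ennreal_mult')
  also have "\<dots> \<le> ennreal (c powr (1 - l) * d powr l) * geometric_mean l p q"
    using less c_pos d_pos by (intro mult_left_mono le_geometric_mean divide_less) auto
  finally show "ennreal (a powr (1 - l) * b powr l)
      \<le> ennreal (c powr (1 - l) * d powr l) * geometric_mean l p q" .
qed

lemma geometric_mean_cmult:
  assumes c_pos: "0 < c" and d_pos: "0 < d"
  shows "geometric_mean l (ennreal c * p) (ennreal d * q)
      = ennreal (c powr (1 - l) * d powr l) * geometric_mean l p q"
proof (rule antisym[OF geometric_mean_cmult_le[OF assms]])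
  have "ennreal (1 / c) * (ennreal c * p) = p" "ennreal (1 / d) * (ennreal d * q) = q"
    using c_pos d_pos by (simp_all flip: ennreal_mult' mult.assoc)
  then have "geometric_mean l p q
      \<le> ennreal ((1 / c) powr (1 - l) * (1 / d) powr l)
          * geometric_mean l (ennreal c * p) (ennreal d * q)"
    using geometric_mean_cmult_le[of "1 / c" "1 / d" l "ennreal c * p" "ennreal d * q"] c_pos d_pos
    by simp
  then have "ennreal (c powr (1 - l) * d powr l) * geometric_mean l p q
      \<le> ennreal (c powr (1 - l) * d powr l) * (ennreal ((1 / c) powr (1 - l) * (1 / d) powr l)
          * geometric_mean l (ennreal c * p) (ennreal d * q))"
    by (rule mult_left_mono) simp
  also have "\<dots> = geometric_mean l (ennreal c * p) (ennreal d * q)"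
    using c_pos d_pos by (simp add: powr_divide flip: ennreal_mult' mult.assoc)
  finally show "ennreal (c powr (1 - l) * d powr l) * geometric_mean l p q
      \<le> geometric_mean l (ennreal c * p) (ennreal d * q)" .
qed

lemma geometric_mean_ennreal:
  assumes weight: "0 < l" "l < 1" and nonneg: "0 \<le> a" "0 \<le> b"
  shows "geometric_mean l (ennreal a) (ennreal b) = ennreal (a powr (1 - l) * b powr l)"
proof (rule antisym)
  show "geometric_mean l (ennreal a) (ennreal b) \<le> ennreal (a powr (1 - l) * b powr l)"
    unfolding geometric_mean_le_iff using weight
    by (auto simp: ennreal_less_iff intro!: ennreal_leI mult_mono powr_mono2)
  have "1 = min (1::ennreal) 1" by simp
  also have "\<dots> \<le> geometric_mean l 1 1" by (rule min_le_geometric_mean)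
  finally have one_le: "1 \<le> geometric_mean l 1 1" .
  show "ennreal (a powr (1 - l) * b powr l) \<le> geometric_mean l (ennreal a) (ennreal b)"
  proof (cases "a = 0 \<or> b = 0")
    case False
    have "ennreal (a powr (1 - l) * b powr l) * 1
        \<le> ennreal (a powr (1 - l) * b powr l) * geometric_mean l 1 1"
      by (intro mult_left_mono one_le) simp
    then show ?thesis
      using geometric_mean_cmult[of a b l 1 1] nonneg False by simp
  qed auto
qed

lemma prekopa_leindler_real_bounded:
  fixes F G H :: "real \<Rightarrow> ennreal"
  assumes weight: "0 < l" "l < 1"
    and [measurable]: "F \<in> borel_measurable borel" "G \<in> borel_measurable borel"
      "H \<in> borel_measurable borel"
    and bounded: "(SUP x. F x) < top" "(SUP x. G x) < top"
    and pointwise: "\<And>x y. geometric_mean l (F x) (G y) \<le> H ((1 - l) * x + l * y)"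
  shows "geometric_mean l (\<integral>\<^sup>+x. F x \<partial>lborel) (\<integral>\<^sup>+x. G x \<partial>lborel) \<le> (\<integral>\<^sup>+x. H x \<partial>lborel)"
proof (cases "(SUP x. F x) = 0 \<or> (SUP x. G x) = 0")
  case True
  then have "(\<forall>x. F x = 0) \<or> (\<forall>x. G x = 0)"
    by (metis SUP_upper UNIV_I le_zero_eq)
  then show ?thesis by auto
next
  case False
  then obtain a b where ab_pos: "0 < a" "0 < b"
    and SUP_ennreal: "(SUP x. F x) = ennreal a" "(SUP x. G x) = ennreal b"
    using bounded by (metis less_top_ennreal ennreal_0 order_le_less)
  define c where "c = (1 / a) powr (1 - l) * (1 / b) powr l"
  have c_pos: "0 < c" using ab_pos by (simp add: c_def)
  define F' where "F' x = ennreal (1 / a) * F x" for x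
  define G' where "G' x = ennreal (1 / b) * G x" for x
  have [measurable]: "F' \<in> borel_measurable borel" "G' \<in> borel_measurable borel"
    unfolding F'_def G'_def by measurable
  have "(SUP x. F' x) = ennreal (1 / a) * ennreal a" "(SUP x. G' x) = ennreal (1 / b) * ennreal b"
    unfolding F'_def G'_def SUP_ennreal[symmetric] by (rule SUP_mult_left_ennreal[symmetric])+
  then have SUP_eq: "(SUP x. F' x) = (SUP x. G' x)"
    using ab_pos by (simp flip: ennreal_mult')
  have min_le: "min (F' x) (G' y) \<le> ennreal c * H ((1 - l) * x + l * y)" for x y
  proof -
    have "min (F' x) (G' y) \<le> geometric_mean l (F' x) (G' y)" by (rule min_le_geometric_mean)
    also have "\<dots> = ennreal c * geometric_mean l (F x) (G y)"
      unfolding F'_def G'_def c_def using ab_pos by (intro geometric_mean_cmult) auto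
    also have "\<dots> \<le> ennreal c * H ((1 - l) * x + l * y)"
      by (intro mult_left_mono pointwise) auto
    finally show ?thesis .
  qed
  have "ennreal c * geometric_mean l (\<integral>\<^sup>+x. F x \<partial>lborel) (\<integral>\<^sup>+x. G x \<partial>lborel)
      = geometric_mean l (\<integral>\<^sup>+x. F' x \<partial>lborel) (\<integral>\<^sup>+x. G' x \<partial>lborel)"
    unfolding F'_def G'_def c_def using ab_pos by (simp add: nn_integral_cmult geometric_mean_cmult)
  also have "\<dots> \<le> ennreal (1 - l) * (\<integral>\<^sup>+x. F' x \<partial>lborel) + ennreal l * (\<integral>\<^sup>+x. G' x \<partial>lborel)"
    by (rule geometric_mean_le_arithmetic_mean[OF weight])
  also have "\<dots> \<le> (\<integral>\<^sup>+x. ennreal c * H x \<partial>lborel)"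
    using weight by (intro brunn_minkowski_real_functional_weighted SUP_eq min_le) auto
  also have "\<dots> = ennreal c * (\<integral>\<^sup>+x. H x \<partial>lborel)"
    by (simp add: nn_integral_cmult)
  finally show ?thesis using c_pos by (subst (asm) ennreal_mult_le_mult_iff) auto
qed

lemma nn_integral_SUP_min_of_nat:
  assumes [measurable]: "F \<in> borel_measurable M"
  shows "(\<integral>\<^sup>+x. F x \<partial>M) = (SUP n. \<integral>\<^sup>+x. min (F x) (of_nat n) \<partial>M)"
proof -
  have "F x = (SUP n. min (F x) (of_nat n))" for x
    using inf_SUP[of "F x" "of_nat :: nat \<Rightarrow> ennreal" UNIV]
    by (simp add: inf_min ennreal_SUP_of_nat_eq_top)
  then have "(\<integral>\<^sup>+x. F x \<partial>M) = (\<integral>\<^sup>+x. (SUP n. min (F x) (of_nat n)) \<partial>M)" by simp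
  also have "\<dots> = (SUP n. \<integral>\<^sup>+x. min (F x) (of_nat n) \<partial>M)"
    by (rule nn_integral_monotone_convergence_SUP)
       (auto simp: incseq_def le_fun_def intro: min.coboundedI1 min.coboundedI2)
  finally show ?thesis .
qed

lemma prekopa_leindler_real:
  fixes F G H :: "real \<Rightarrow> ennreal"
  assumes weight: "0 < l" "l < 1"
    and [measurable]: "F \<in> borel_measurable borel" "G \<in> borel_measurable borel"
      "H \<in> borel_measurable borel"
    and pointwise: "\<And>x y. geometric_mean l (F x) (G y) \<le> H ((1 - l) * x + l * y)"
  shows "geometric_mean l (\<integral>\<^sup>+x. F x \<partial>lborel) (\<integral>\<^sup>+x. G x \<partial>lborel) \<le> (\<integral>\<^sup>+x. H x \<partial>lborel)"
proof -
  have bounded: "(SUP x. min (K x) (of_nat n)) < top" for K :: "real \<Rightarrow> ennreal" and n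
  proof -
    have "(SUP x. min (K x) (of_nat n)) \<le> of_nat n" by (rule SUP_least) simp
    then show ?thesis by (rule le_less_trans) (rule of_nat_less_top)
  qed
  have "geometric_mean l (\<integral>\<^sup>+x. min (F x) (of_nat m) \<partial>lborel) (\<integral>\<^sup>+x. min (G x) (of_nat n) \<partial>lborel)
      \<le> (\<integral>\<^sup>+x. H x \<partial>lborel)" for m n
  proof (rule prekopa_leindler_real_bounded[OF weight _ _ _ bounded bounded])
    show "geometric_mean l (min (F x) (of_nat m)) (min (G y) (of_nat n))
        \<le> H ((1 - l) * x + l * y)" for x y
      by (rule order_trans[OF geometric_mean_mono pointwise]) simp_all
  qed measurable
  then show ?thesis
    unfolding nn_integral_SUP_min_of_nat[OF assms(3)[folded measurable_lborel2]]
      nn_integral_SUP_min_of_nat[OF assms(4)[folded measurable_lborel2]]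
    by (rule geometric_mean_SUP_le)
qed

lemma borel_measurable_PiM_slice:
  fixes K :: "('i \<Rightarrow> real) \<Rightarrow> ennreal"
  assumes "finite I" and measurable_K: "K \<in> borel_measurable (Pi\<^sub>M (insert i I) (\<lambda>_. lborel))"
  shows "(\<lambda>x. K (x(i := s))) \<in> borel_measurable (Pi\<^sub>M I (\<lambda>_. lborel))"
    and "(\<lambda>s. \<integral>\<^sup>+x. K (x(i := s)) \<partial>Pi\<^sub>M I (\<lambda>_. lborel)) \<in> borel_measurable borel"
proof -
  interpret product_sigma_finite "\<lambda>_::'i. lborel :: real measure" by standard
  interpret sigma_finite_measure "Pi\<^sub>M I (\<lambda>_. lborel :: real measure)"
    by (rule sigma_finite) (rule assms(1))
  have "(\<lambda>(s, x). x(i := s)) \<in> lborel \<Otimes>\<^sub>M Pi\<^sub>M I (\<lambda>_. lborel) \<rightarrow>\<^sub>M Pi\<^sub>M (insert i I) (\<lambda>_. lborel)"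
    by measurable
  from measurable_compose[OF this measurable_K]
  have [measurable]: "(\<lambda>(s, x). K (x(i := s))) \<in> borel_measurable (lborel \<Otimes>\<^sub>M Pi\<^sub>M I (\<lambda>_. lborel))"
    by (simp add: split_beta')
  show "(\<lambda>x. K (x(i := s))) \<in> borel_measurable (Pi\<^sub>M I (\<lambda>_. lborel))"
    and "(\<lambda>s. \<integral>\<^sup>+x. K (x(i := s)) \<partial>Pi\<^sub>M I (\<lambda>_. lborel)) \<in> borel_measurable borel"
    by measurable
qed

lemma prekopa_leindler_PiM:
  fixes F G H :: "('i \<Rightarrow> real) \<Rightarrow> ennreal"
  assumes weight: "0 < l" "l < 1" and "finite I"
    and "F \<in> borel_measurable (Pi\<^sub>M I (\<lambda>_. lborel))" "G \<in> borel_measurable (Pi\<^sub>M I (\<lambda>_. lborel))"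
      "H \<in> borel_measurable (Pi\<^sub>M I (\<lambda>_. lborel))"
    and "\<And>x y. x \<in> extensional I \<Longrightarrow> y \<in> extensional I
      \<Longrightarrow> geometric_mean l (F x) (G y) \<le> H (\<lambda>i\<in>I. (1 - l) * x i + l * y i)"
  shows "geometric_mean l (\<integral>\<^sup>+x. F x \<partial>Pi\<^sub>M I (\<lambda>_. lborel)) (\<integral>\<^sup>+x. G x \<partial>Pi\<^sub>M I (\<lambda>_. lborel))
    \<le> (\<integral>\<^sup>+x. H x \<partial>Pi\<^sub>M I (\<lambda>_. lborel))"
  using assms(3-)
proof (induction I arbitrary: F G H)
  case empty
  interpret product_sigma_finite "\<lambda>_::'i. lborel :: real measure" by standard
  have "geometric_mean l (F (\<lambda>_. undefined)) (G (\<lambda>_. undefined)) \<le> H (\<lambda>_. undefined)"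
    using empty(4)[of "\<lambda>_. undefined" "\<lambda>_. undefined"] by (simp add: restrict_def)
  then show ?case by (simp add: nn_integral_empty)
next
  case (insert i I)
  interpret product_sigma_finite "\<lambda>_::'i. lborel :: real measure" by standard
  define slice where "slice K s = (\<integral>\<^sup>+x. K (x(i := s)) \<partial>Pi\<^sub>M I (\<lambda>_. lborel))"
    for K :: "('i \<Rightarrow> real) \<Rightarrow> ennreal" and s
  have integral_slice: "integral\<^sup>N (Pi\<^sub>M (insert i I) (\<lambda>_. lborel)) K = (\<integral>\<^sup>+s. slice K s \<partial>lborel)"
    if "K \<in> borel_measurable (Pi\<^sub>M (insert i I) (\<lambda>_. lborel))" for K
    unfolding slice_def using insert.hyps that by (intro product_nn_integral_insert_rev) auto
  have "geometric_mean l (slice F s) (slice G u) \<le> slice H ((1 - l) * s + l * u)" for s u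
    unfolding slice_def
  proof (rule insert.IH)
    fix x y :: "'i \<Rightarrow> real" assume extensional: "x \<in> extensional I" "y \<in> extensional I"
    have "(\<lambda>j\<in>insert i I. (1 - l) * (x(i := s)) j + l * (y(i := u)) j)
        = (\<lambda>j\<in>I. (1 - l) * x j + l * y j)(i := (1 - l) * s + l * u)"
      using insert.hyps by (auto simp: fun_eq_iff restrict_def)
    moreover have "x(i := s) \<in> extensional (insert i I)" "y(i := u) \<in> extensional (insert i I)"
      using extensional by (auto simp: extensional_def)
    ultimately show "geometric_mean l (F (x(i := s))) (G (y(i := u)))
        \<le> H ((\<lambda>j\<in>I. (1 - l) * x j + l * y j)(i := (1 - l) * s + l * u))"
      using insert.prems(4)[of "x(i := s)" "y(i := u)"] by metis
  qed (rule borel_measurable_PiM_slice insert)+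
  then show ?case
    unfolding integral_slice[OF insert.prems(1)] integral_slice[OF insert.prems(2)]
      integral_slice[OF insert.prems(3)]
    using borel_measurable_PiM_slice(2)[OF insert.hyps(1)] insert.prems(1-3)
    by (intro prekopa_leindler_real weight) (simp_all add: slice_def[abs_def])
qed

lemma prekopa_leindler_lborel:
  fixes F G H :: "'a::euclidean_space \<Rightarrow> ennreal"
  assumes weight: "0 < l" "l < 1"
    and [measurable]: "F \<in> borel_measurable borel" "G \<in> borel_measurable borel"
      "H \<in> borel_measurable borel"
    and pointwise: "\<And>x y. geometric_mean l (F x) (G y) \<le> H ((1 - l) *\<^sub>R x + l *\<^sub>R y)"
  shows "geometric_mean l (\<integral>\<^sup>+x. F x \<partial>lborel) (\<integral>\<^sup>+x. G x \<partial>lborel) \<le> (\<integral>\<^sup>+x. H x \<partial>lborel)"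
proof -
  define vec :: "('a \<Rightarrow> real) \<Rightarrow> 'a" where "vec x = (\<Sum>b\<in>Basis. x b *\<^sub>R b)" for x
  have [measurable]: "vec \<in> Pi\<^sub>M Basis (\<lambda>_. lborel) \<rightarrow>\<^sub>M borel"
    unfolding vec_def by measurable
  have integral_vec: "(\<integral>\<^sup>+x. K x \<partial>lborel) = (\<integral>\<^sup>+x. K (vec x) \<partial>Pi\<^sub>M Basis (\<lambda>_. lborel))"
    if [measurable]: "K \<in> borel_measurable borel" for K :: "'a \<Rightarrow> ennreal"
    by (subst lborel_eq, subst nn_integral_distr) (simp_all add: vec_def[symmetric, abs_def])
  have "vec (\<lambda>b\<in>Basis. (1 - l) * x b + l * y b) = (1 - l) *\<^sub>R vec x + l *\<^sub>R vec y" for x y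
    by (simp add: vec_def scaleR_sum_right scaleR_left_distrib sum.distrib)
  then show ?thesis
    unfolding integral_vec[OF assms(3)] integral_vec[OF assms(4)] integral_vec[OF assms(5)]
    using weight pointwise by (intro prekopa_leindler_PiM) auto
qed

text \<open>A Lebesgue measurable function agrees almost everywhere with a Borel one; moving \<open>F\<close> and \<open>G\<close> down
  to \<open>0\<close> and \<open>H\<close> up to \<open>\<infinity>\<close> on the exceptional null set preserves the pointwise hypothesis.\<close>

lemma prekopa_leindler_lebesgue:
  fixes F G H :: "'a::euclidean_space \<Rightarrow> ennreal"
  assumes weight: "0 < l" "l < 1"
    and measurable_FGH: "F \<in> borel_measurable lebesgue" "G \<in> borel_measurable lebesgue"
      "H \<in> borel_measurable lebesgue"
    and pointwise: "\<And>x y. geometric_mean l (F x) (G y) \<le> H ((1 - l) *\<^sub>R x + l *\<^sub>R y)"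
  shows "geometric_mean l (\<integral>\<^sup>+x. F x \<partial>lebesgue) (\<integral>\<^sup>+x. G x \<partial>lebesgue) \<le> (\<integral>\<^sup>+x. H x \<partial>lebesgue)"
proof -
  obtain F_borel G_borel H_borel where [measurable]: "F_borel \<in> borel_measurable borel"
    "G_borel \<in> borel_measurable borel" "H_borel \<in> borel_measurable borel"
    and AE_eq: "AE x in lborel. F x = F_borel x" "AE x in lborel. G x = G_borel x"
      "AE x in lborel. H x = H_borel x"
    using measurable_FGH[THEN completion_ex_borel_measurable] by (auto simp: measurable_lborel1)
  have "AE x in lborel. F x = F_borel x \<and> G x = G_borel x \<and> H x = H_borel x"
    using AE_eq by eventually_elim auto
  then obtain N where exceptional: "\<And>x. x \<notin> N \<Longrightarrow> F x = F_borel x \<and> G x = G_borel x \<and> H x = H_borel x"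
    "N \<in> null_sets lborel"
    by (rule AE_E3) auto
  then have [measurable]: "N \<in> sets borel" by (auto simp: null_sets_def)
  define F' where "F' x = (if x \<in> N then 0 else F_borel x)" for x
  define G' where "G' x = (if x \<in> N then 0 else G_borel x)" for x
  define H' where "H' x = (if x \<in> N then top else H_borel x)" for x
  have [measurable]: "F' \<in> borel_measurable borel" "G' \<in> borel_measurable borel"
    "H' \<in> borel_measurable borel"
    unfolding F'_def G'_def H'_def by measurable
  have "F' x \<le> F x" "G' x \<le> G x" "H x \<le> H' x" for x
    using exceptional(1) by (auto simp: F'_def G'_def H'_def)
  then have "geometric_mean l (F' x) (G' y) \<le> H' ((1 - l) *\<^sub>R x + l *\<^sub>R y)" for x y
    using geometric_mean_mono[of "F' x" "F x" "G' y" "G y" l] pointwise[of x y] by (meson order_trans)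
  then have "geometric_mean l (\<integral>\<^sup>+x. F' x \<partial>lborel) (\<integral>\<^sup>+x. G' x \<partial>lborel) \<le> (\<integral>\<^sup>+x. H' x \<partial>lborel)"
    using weight by (intro prekopa_leindler_lborel) auto
  moreover have "(\<integral>\<^sup>+x. F x \<partial>lborel) = (\<integral>\<^sup>+x. F' x \<partial>lborel)"
    "(\<integral>\<^sup>+x. G x \<partial>lborel) = (\<integral>\<^sup>+x. G' x \<partial>lborel)"
      "(\<integral>\<^sup>+x. H x \<partial>lborel) = (\<integral>\<^sup>+x. H' x \<partial>lborel)"
    using AE_eq AE_not_in[OF exceptional(2)]
    by (auto intro!: nn_integral_cong_AE simp: F'_def G'_def H'_def)
  ultimately show ?thesis by (simp add: nn_integral_completion)
qed

theorem prekopa_leindler: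
  fixes f g h :: "'a::euclidean_space \<Rightarrow> real"
  assumes weight: "0 < l" "l < 1"
    and integrable: "integrable lebesgue f" "integrable lebesgue g" "integrable lebesgue h"
    and nonneg: "\<And>x. 0 \<le> f x" "\<And>x. 0 \<le> g x" "\<And>x. 0 \<le> h x"
    and pointwise: "\<And>x y. f x powr (1 - l) * g y powr l \<le> h ((1 - l) *\<^sub>R x + l *\<^sub>R y)"
  shows "(LINT x|lebesgue. f x) powr (1 - l) * (LINT x|lebesgue. g x) powr l \<le> (LINT x|lebesgue. h x)"
proof -
  have "geometric_mean l (\<integral>\<^sup>+x. f x \<partial>lebesgue) (\<integral>\<^sup>+x. g x \<partial>lebesgue) \<le> (\<integral>\<^sup>+x. h x \<partial>lebesgue)"
    using weight integrable nonneg pointwise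
    by (intro prekopa_leindler_lebesgue) (auto simp: geometric_mean_ennreal intro: ennreal_leI)
  then show ?thesis
    using weight integrable nonneg by (simp add: nn_integral_eq_integral geometric_mean_ennreal)
qed

section \<open>Mellin integrals\<close>

definition has_mellin :: "(real \<Rightarrow> real) \<Rightarrow> real \<Rightarrow> real \<Rightarrow> bool" where
  "has_mellin h \<alpha> I \<longleftrightarrow>
    has_bochner_integral lborel (\<lambda>t. indicator {0<..} t * (t powr (\<alpha> - 1) * h t)) I"

definition mellin :: "(real \<Rightarrow> real) \<Rightarrow> real \<Rightarrow> real" where
  "mellin h \<alpha> = (LINT t:{0<..}|lborel. t powr (\<alpha> - 1) * h t)"

abbreviation mellin_integrable :: "(real \<Rightarrow> real) \<Rightarrow> real \<Rightarrow> bool" where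
  "mellin_integrable h \<alpha> \<equiv> has_mellin h \<alpha> (mellin h \<alpha>)"

lemma mellin_eqI: "has_mellin h \<alpha> I \<Longrightarrow> mellin h \<alpha> = I"
  by (simp add: has_mellin_def mellin_def set_lebesgue_integral_def has_bochner_integral_integral_eq)

lemma has_mellin_imp_mellin_integrable: "has_mellin h \<alpha> I \<Longrightarrow> mellin_integrable h \<alpha>"
  by (simp add: mellin_eqI)

lemma mellin_cong:
  assumes "\<And>t. 0 < t \<Longrightarrow> h t = h' t"
  shows "mellin h \<alpha> = mellin h' \<alpha>"
  unfolding mellin_def using assms by (intro set_lebesgue_integral_cong) auto

lemma has_mellin_add:
  "has_mellin h \<alpha> I \<Longrightarrow> has_mellin h' \<alpha> J \<Longrightarrow> has_mellin (\<lambda>t. h t + h' t) \<alpha> (I + J)"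
  using has_bochner_integral_add unfolding has_mellin_def distrib_left by blast

lemma has_mellin_minus: "has_mellin h \<alpha> I \<Longrightarrow> has_mellin (\<lambda>t. - h t) \<alpha> (- I)"
  using has_bochner_integral_minus[of lborel "\<lambda>t. indicator {0<..} t * (t powr (\<alpha> - 1) * h t)" I]
  by (simp add: has_mellin_def)

lemma has_mellin_diff:
  "has_mellin h \<alpha> I \<Longrightarrow> has_mellin h' \<alpha> J \<Longrightarrow> has_mellin (\<lambda>t. h t - h' t) \<alpha> (I - J)"
  using has_mellin_add[OF _ has_mellin_minus] by fastforce

lemma has_mellin_dilate:
  assumes has_mellin_h: "has_mellin h \<alpha> I" and k_pos: "0 < k"
  shows "has_mellin (\<lambda>t. h (k * t)) \<alpha> (I * k powr - \<alpha>)"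
proof -
  have "has_bochner_integral lborel
      (\<lambda>t. indicator {0<..} (0 + k * t) * ((0 + k * t) powr (\<alpha> - 1) * h (0 + k * t))) (I /\<^sub>R \<bar>k\<bar>)"
    using lborel_has_bochner_integral_real_affine_iff
      [THEN iffD1, OF _ has_mellin_h[unfolded has_mellin_def], of k 0] k_pos
    by simp
  then have "has_bochner_integral lborel
      (\<lambda>t. k powr (1 - \<alpha>) * (indicator {0<..} (0 + k * t) * ((0 + k * t) powr (\<alpha> - 1) * h (0 + k * t))))
      (k powr (1 - \<alpha>) * (I /\<^sub>R \<bar>k\<bar>))"
    by (rule has_bochner_integral_mult_right)
  moreover have "k powr (1 - \<alpha>) * (I /\<^sub>R \<bar>k\<bar>) = I * k powr - \<alpha>"
    using k_pos by (simp add: powr_diff powr_minus field_simps)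
  moreover have "k powr (1 - \<alpha>)
        * (indicator {0<..} (0 + k * t) * ((0 + k * t) powr (\<alpha> - 1) * h (0 + k * t)))
      = indicator {0<..} t * (t powr (\<alpha> - 1) * h (k * t))" for t
    using k_pos by (auto simp: indicator_def zero_less_mult_iff powr_mult powr_diff)
  ultimately show ?thesis by (simp only: has_mellin_def)
qed

lemma has_mellin_mono:
  assumes "has_mellin h \<alpha> I" "has_mellin h' \<beta> J"
    and "\<And>t. 0 < t \<Longrightarrow> t powr (\<alpha> - 1) * h t \<le> c * (t powr (\<beta> - 1) * h' t)"
  shows "I \<le> c * J"
proof -
  let ?h = "\<lambda>t. indicator {0<..} t * (t powr (\<alpha> - 1) * h t)"
  let ?h' = "\<lambda>t. indicator {0<..} t * (t powr (\<beta> - 1) * h' t)"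
  have integral_h: "integrable lborel ?h" "integral\<^sup>L lborel ?h = I"
    and integral_h': "integrable lborel ?h'" "integral\<^sup>L lborel ?h' = J"
    using assms(1,2) by (auto simp: has_mellin_def has_bochner_integral_iff)
  have "integral\<^sup>L lborel ?h \<le> (LINT t|lborel. c * ?h' t)"
    using assms(3)
    by (intro integral_mono integral_h(1) integrable_mult_right integral_h'(1))
      (auto simp: indicator_def)
  then show ?thesis using integral_h(2) integral_h'(2) by simp
qed

lemma integral_pos_if_pos_on:
  fixes f :: "'a \<Rightarrow> real"
  assumes "integrable M f" "AE x in M. 0 \<le> f x"
    and A_pos: "A \<in> sets M" "emeasure M A \<noteq> 0" "\<And>x. x \<in> A \<Longrightarrow> 0 < f x"
  shows "0 < (LINT x|M. f x)"
proof (rule ccontr)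
  assume "\<not> ?thesis"
  moreover have "0 \<le> (LINT x|M. f x)" by (rule integral_nonneg_AE) fact
  ultimately have "(LINT x|M. f x) = 0" by simp
  then have "AE x in M. f x = 0" using assms(1,2) by (simp add: integral_nonneg_eq_0_iff_AE)
  then have "AE x in M. x \<notin> A" by eventually_elim (use A_pos(3) in force)
  then have "A \<in> null_sets M" using A_pos(1) by (subst AE_iff_null_sets)
  then show False using A_pos(2) by (simp add: null_sets_def)
qed

lemma has_mellin_pos:
  assumes has_mellin_h: "has_mellin h \<alpha> I" and nonneg: "\<And>t. 0 < t \<Longrightarrow> 0 \<le> h t"
    and interval: "0 \<le> a" "a < b" "\<And>t. a < t \<Longrightarrow> t < b \<Longrightarrow> 0 < h t"
  shows "0 < I"
proof -
  have "0 < (LINT t|lborel. indicator {0<..} t * (t powr (\<alpha> - 1) * h t))"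
  proof (rule integral_pos_if_pos_on)
    show "integrable lborel (\<lambda>t. indicator {0<..} t * (t powr (\<alpha> - 1) * h t))"
      using has_mellin_h by (auto simp: has_mellin_def has_bochner_integral_iff)
    show "AE t in lborel. 0 \<le> indicator {0<..} t * (t powr (\<alpha> - 1) * h t)"
      using nonneg by (auto simp: indicator_def)
    show "{a<..<b} \<in> sets lborel" "emeasure lborel {a<..<b} \<noteq> 0" using interval by auto
    show "0 < indicator {0<..} t * (t powr (\<alpha> - 1) * h t)" if "t \<in> {a<..<b}" for t
      using that interval by auto
  qed
  then show ?thesis using has_mellin_h by (simp add: has_mellin_def has_bochner_integral_integral_eq)
qed

lemma mellin_integrable_bound:
  assumes has_mellin_h': "has_mellin h' \<alpha> J" and measurable_h: "set_borel_measurable lborel {0<..} h"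
    and bound: "\<And>t. 0 < t \<Longrightarrow> \<bar>h t\<bar> \<le> h' t"
  shows "mellin_integrable h \<alpha>"
proof -
  have "integrable lborel (\<lambda>t. indicator {0<..} t * (t powr (\<alpha> - 1) * h t))"
  proof (rule Bochner_Integration.integrable_bound)
    show "integrable lborel (\<lambda>t. indicator {0<..} t * (t powr (\<alpha> - 1) * h' t))"
      using has_mellin_h' by (auto simp: has_mellin_def has_bochner_integral_iff)
    have "(\<lambda>t. t powr (\<alpha> - 1) * (indicator {0<..} t *\<^sub>R h t)) \<in> borel_measurable lborel"
      using measurable_h unfolding set_borel_measurable_def by (intro borel_measurable_times) auto
    then show "(\<lambda>t. indicator {0<..} t * (t powr (\<alpha> - 1) * h t)) \<in> borel_measurable lborel"
      by (simp add: mult.left_commute)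
    have "norm (t powr (\<alpha> - 1) * h t) \<le> norm (t powr (\<alpha> - 1) * h' t)" if "0 < t" for t
      using bound[OF that] by (simp add: abs_mult mult_left_mono)
    then show "AE t in lborel. norm (indicator {0<..} t * (t powr (\<alpha> - 1) * h t))
        \<le> norm (indicator {0<..} t * (t powr (\<alpha> - 1) * h' t))"
      by (auto simp: indicator_def)
  qed
  then show ?thesis
    by (simp add: has_mellin_def mellin_def set_lebesgue_integral_def has_bochner_integral_iff)
qed

lemma has_mellin_iff_nn_integral:
  assumes [measurable]: "h \<in> borel_measurable borel" and nonneg: "\<And>t. 0 < t \<Longrightarrow> 0 \<le> h t"
  shows "has_mellin h \<alpha> I \<longleftrightarrow>
    0 \<le> I \<and> (\<integral>\<^sup>+t. ennreal (indicator {0<..} t * (t powr (\<alpha> - 1) * h t)) \<partial>lborel) = ennreal I"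
  (is "_ \<longleftrightarrow> 0 \<le> I \<and> (\<integral>\<^sup>+t. ennreal (?h t) \<partial>lborel) = _")
proof -
  have nonneg': "0 \<le> ?h t" for t using nonneg by (auto simp: indicator_def)
  have "(\<integral>\<^sup>+t. ennreal (?h t) \<partial>lborel) = ennreal I" "0 \<le> I" if "has_bochner_integral lborel ?h I"
    using that nonneg' by (auto simp: has_bochner_integral_iff nn_integral_eq_integral)
  moreover have "has_bochner_integral lborel ?h I"
    if "0 \<le> I" "(\<integral>\<^sup>+t. ennreal (?h t) \<partial>lborel) = ennreal I"
    using that nonneg' by (intro has_bochner_integral_nn_integral) auto
  ultimately show ?thesis unfolding has_mellin_def by blast
qed

lemma has_mellin_exp:
  assumes exponent: "0 < \<alpha>" and k_pos: "0 < k"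
  shows "has_mellin (\<lambda>t. exp (- (k * t))) \<alpha> (Gamma \<alpha> * k powr - \<alpha>)"
proof -
  have "ennreal (Gamma \<alpha>) = (\<integral>\<^sup>+t. ennreal (indicator {0..} t * t powr (\<alpha> - 1) / exp t) \<partial>lborel)"
    using exponent by (rule Gamma_conv_nn_integral_real)
  also have "\<dots> = (\<integral>\<^sup>+t. ennreal (indicator {0<..} t * (t powr (\<alpha> - 1) * exp (- t))) \<partial>lborel)"
    by (intro nn_integral_cong) (auto simp: indicator_def exp_minus divide_inverse)
  finally have "has_mellin (\<lambda>t. exp (- t)) \<alpha> (Gamma \<alpha>)"
    using Gamma_real_pos[OF exponent] by (subst has_mellin_iff_nn_integral) auto
  then show ?thesis using k_pos by (rule has_mellin_dilate)
qed

lemma nn_integral_powr_exp_Icc: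
  assumes t_pos: "0 < t" and ab_le: "a \<le> b"
  shows "(\<integral>\<^sup>+u. ennreal (t powr \<alpha> * exp (- (u * t))) * indicator {a..b} u \<partial>lborel)
    = ennreal (t powr (\<alpha> - 1) * (exp (- (a * t)) - exp (- (b * t))))"
proof -
  have "(\<integral>\<^sup>+u. ennreal (t powr \<alpha> * exp (- (u * t))) * indicator {a..b} u \<partial>lborel)
      = ennreal (- (t powr (\<alpha> - 1) * exp (- (b * t))) - - (t powr (\<alpha> - 1) * exp (- (a * t))))"
    by (rule nn_integral_FTC_Icc)
       (use assms in \<open>auto intro!: derivative_eq_intros simp: powr_diff\<close>)
  then show ?thesis by (simp add: algebra_simps)
qed

text \<open>Tonelli applied to \<open>exp (- a t) - exp (- b t) = \<integral> t exp (- u t) du\<close> over \<open>u \<in> [a, b]\<close>.\<close>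

lemma has_mellin_exp_diff:
  assumes exponent: "-1 < \<alpha>" and interval: "0 \<le> a" "a \<le> b"
    and integral_powr: "((\<lambda>u. u powr - (\<alpha> + 1)) has_integral J) {a..b}"
  shows "has_mellin (\<lambda>t. exp (- (a * t)) - exp (- (b * t))) \<alpha> (Gamma (\<alpha> + 1) * J)"
proof -
  define w where "w u t
      = ennreal (indicator {a..b} u * (indicator {0<..} t * (t powr \<alpha> * exp (- (u * t)))))" for u t
  have [measurable]: "(\<lambda>(u, t). w u t) \<in> borel_measurable (lborel \<Otimes>\<^sub>M lborel)"
    unfolding w_def by measurable
  have integral_over_u: "(\<integral>\<^sup>+u. w u t \<partial>lborel)
      = ennreal (indicator {0<..} t * (t powr (\<alpha> - 1) * (exp (- (a * t)) - exp (- (b * t)))))" for t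
  proof (cases "0 < t")
    case True
    then have "(\<integral>\<^sup>+u. w u t \<partial>lborel)
        = (\<integral>\<^sup>+u. ennreal (t powr \<alpha> * exp (- (u * t))) * indicator {a..b} u \<partial>lborel)"
      by (intro nn_integral_cong) (auto simp: w_def indicator_def)
    then show ?thesis using True interval by (simp add: nn_integral_powr_exp_Icc)
  qed (simp add: w_def)
  have integral_over_t: "(\<integral>\<^sup>+t. w u t \<partial>lborel)
      = ennreal (Gamma (\<alpha> + 1)) * ennreal (indicator {a..b} u * u powr - (\<alpha> + 1))"
    if "u \<noteq> 0" for u
  proof (cases "u \<in> {a..b}")
    case True
    have "has_mellin (\<lambda>t. exp (- (u * t))) (\<alpha> + 1) (Gamma (\<alpha> + 1) * u powr - (\<alpha> + 1))"
      using True that interval exponent by (intro has_mellin_exp) auto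
    then show ?thesis
      using True by (subst (asm) has_mellin_iff_nn_integral) (auto simp: w_def ennreal_mult'')
  qed (simp add: w_def)
  have nn_integral_powr: "(\<integral>\<^sup>+u. ennreal (indicator {a..b} u * u powr - (\<alpha> + 1)) \<partial>lborel) = ennreal J"
    "0 \<le> J"
    using integral_powr by (auto intro!: nn_integral_has_integral_lebesgue intro: has_integral_nonneg)
  have "(\<integral>\<^sup>+t. (\<integral>\<^sup>+u. w u t \<partial>lborel) \<partial>lborel) = (\<integral>\<^sup>+u. (\<integral>\<^sup>+t. w u t \<partial>lborel) \<partial>lborel)"
    by (rule lborel_pair.Fubini') measurable
  also have "\<dots>
      = (\<integral>\<^sup>+u. ennreal (Gamma (\<alpha> + 1)) * ennreal (indicator {a..b} u * u powr - (\<alpha> + 1)) \<partial>lborel)"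
    by (rule nn_integral_cong_AE, rule AE_mp[OF AE_lborel_singleton[of "0::real"]])
      (auto simp: integral_over_t)
  also have "\<dots> = ennreal (Gamma (\<alpha> + 1) * J)"
    using nn_integral_powr by (simp add: nn_integral_cmult ennreal_mult'')
  finally show ?thesis
    using interval nn_integral_powr(2) exponent
    unfolding integral_over_u by (subst has_mellin_iff_nn_integral) auto
qed

lemma Gamma_plus1_real: "-1 < \<alpha> \<Longrightarrow> \<alpha> \<noteq> 0 \<Longrightarrow> Gamma (\<alpha> + 1) = \<alpha> * Gamma \<alpha>" for \<alpha> :: real
  by (rule Gamma_plus1) (auto elim!: nonpos_Ints_cases)

text \<open>Subtracting the value at \<open>0\<close> continues the Gamma integral analytically to \<open>-1 < \<alpha> < 0\<close>.\<close>

lemma has_mellin_exp_regularized: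
  assumes exponent: "-1 < \<alpha>" "\<alpha> \<noteq> 0" and k_pos: "0 < k"
  shows "has_mellin (\<lambda>t. exp (- (k * t)) - (if \<alpha> < 0 then 1 else 0)) \<alpha> (Gamma \<alpha> * k powr - \<alpha>)"
proof (cases "\<alpha> < 0")
  case True
  have "((\<lambda>u. u powr - (\<alpha> + 1)) has_integral k powr (- (\<alpha> + 1) + 1) / (- (\<alpha> + 1) + 1)) {0..k}"
    using True k_pos by (intro has_integral_powr_from_0) auto
  then have "has_mellin (\<lambda>t. exp (- (0 * t)) - exp (- (k * t))) \<alpha> (Gamma (\<alpha> + 1) * (k powr - \<alpha> / - \<alpha>))"
    using exponent k_pos by (intro has_mellin_exp_diff) auto
  from has_mellin_minus[OF this] show ?thesis
    using True exponent by (simp add: Gamma_plus1_real)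
qed (use has_mellin_exp[of \<alpha> k] assms in simp)

lemma has_mellin_frullani_exp:
  assumes ab_pos: "0 < a" "0 < b"
  shows "has_mellin (\<lambda>t. exp (- (a * t)) - exp (- (b * t))) 0 (ln b - ln a)"
proof -
  have ordered: "has_mellin (\<lambda>t. exp (- (a * t)) - exp (- (b * t))) 0 (ln b - ln a)"
    if ab_pos: "0 < a" "a \<le> b" for a b
  proof -
    have "((\<lambda>u. u powr - 1) has_integral (ln b - ln a)) {a..b}"
      by (rule fundamental_theorem_of_calculus)
         (use ab_pos in \<open>auto intro!: derivative_eq_intros
           simp: powr_minus divide_inverse has_real_derivative_iff_has_vector_derivative[symmetric]\<close>)
    then show ?thesis using has_mellin_exp_diff[of 0 a b] ab_pos by simp
  qed
  show ?thesis
  proof (cases "a \<le> b")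
    case False
    then show ?thesis using has_mellin_minus[OF ordered[of b a]] ab_pos by simp
  qed (use ordered ab_pos in auto)
qed

lemma sign_change_point:
  fixes d :: "real \<Rightarrow> real"
  assumes downward: "\<And>s t. 0 < s \<Longrightarrow> s \<le> t \<Longrightarrow> 0 \<le> d t \<Longrightarrow> 0 \<le> d s"
    and neg: "\<exists>t>0. d t < 0"
  obtains \<tau> where "0 \<le> \<tau>" "\<forall>t>0. t < \<tau> \<longrightarrow> 0 \<le> d t" "\<forall>t>\<tau>. d t \<le> 0"
proof
  define N where "N = {t. 0 < t \<and> d t < 0}"
  have N_bdd: "N \<noteq> {}" "bdd_below N" using neg by (auto simp: N_def intro: bdd_belowI[of _ 0])
  show "0 \<le> Inf N" using N_bdd(1) by (rule cInf_greatest) (simp add: N_def)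
  show "\<forall>t>0. t < Inf N \<longrightarrow> 0 \<le> d t"
    using cInf_lower[OF _ N_bdd(2)] by (force simp: N_def)
  show "\<forall>t>Inf N. d t \<le> 0"
  proof (intro allI impI)
    fix t assume "Inf N < t"
    then obtain s where "s \<in> N" "s < t" using cInf_less_iff[OF N_bdd, of t] by auto
    then show "d t \<le> 0" using downward[of s t] by (force simp: N_def)
  qed
qed

lemma has_mellin_nonneg_eq_0:
  assumes nonneg: "\<And>t. 0 < t \<Longrightarrow> 0 \<le> d t"
    and has_mellin_I: "has_mellin d \<alpha> I" "I \<le> 0" and has_mellin_J: "has_mellin d \<beta> J"
  shows "J = 0"
proof -
  have integrable: "integrable lborel (\<lambda>t. indicator {0<..} t * (t powr (\<alpha> - 1) * d t))"
    and integral_le: "(LINT t|lborel. indicator {0<..} t * (t powr (\<alpha> - 1) * d t)) \<le> 0"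
    using has_mellin_I by (auto simp: has_mellin_def has_bochner_integral_iff)
  have integrand_nonneg: "0 \<le> indicator {0<..} t * (t powr (\<alpha> - 1) * d t)" for t
    using nonneg by (auto simp: indicator_def)
  then have "(LINT t|lborel. indicator {0<..} t * (t powr (\<alpha> - 1) * d t)) = 0"
    using integral_le by (intro antisym integral_nonneg_AE) auto
  then have "AE t in lborel. indicator {0<..} t * (t powr (\<alpha> - 1) * d t) = 0"
    using integrable integrand_nonneg by (simp add: integral_nonneg_eq_0_iff_AE)
  then have "AE t in lborel. indicator {0<..} t * (t powr (\<beta> - 1) * d t) = 0"
    by eventually_elim (auto simp: indicator_def)
  then show ?thesis
    using has_mellin_J by (auto simp: has_mellin_def has_bochner_integral_iff integral_eq_zero_AE)
qed

lemma has_mellin_single_crossing: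
  assumes exponents: "\<alpha> < \<beta>" and has_mellin_I: "has_mellin d \<alpha> I" "I \<le> 0"
    and has_mellin_J: "has_mellin d \<beta> J"
    and downward: "\<And>s t. 0 < s \<Longrightarrow> s \<le> t \<Longrightarrow> 0 \<le> d t \<Longrightarrow> 0 \<le> d s"
  shows "J \<le> 0"
proof (cases "\<forall>t>0. 0 \<le> d t")
  case True
  then show ?thesis using has_mellin_nonneg_eq_0[OF _ has_mellin_I has_mellin_J] by simp
next
  case False
  then have "\<exists>t>0. d t < 0" by (auto simp: not_le)
  with downward obtain \<tau> where crossing: "0 \<le> \<tau>" "\<forall>t>0. t < \<tau> \<longrightarrow> 0 \<le> d t" "\<forall>t>\<tau>. d t \<le> 0"
    by (rule sign_change_point) blast
  have "t powr (\<beta> - 1) * d t \<le> \<tau> powr (\<beta> - \<alpha>) * (t powr (\<alpha> - 1) * d t)" if t_pos: "0 < t" for t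
  proof -
    have "t powr (\<beta> - \<alpha>) * d t \<le> \<tau> powr (\<beta> - \<alpha>) * d t"
    proof (cases t \<tau> rule: linorder_cases)
      case less
      then show ?thesis using crossing t_pos exponents by (intro mult_right_mono powr_mono2) auto
    next
      case greater
      then show ?thesis using crossing t_pos exponents by (intro mult_right_mono_neg powr_mono2) auto
    qed simp
    then have "t powr (\<alpha> - 1) * (t powr (\<beta> - \<alpha>) * d t) \<le> t powr (\<alpha> - 1) * (\<tau> powr (\<beta> - \<alpha>) * d t)"
      by (rule mult_left_mono) simp
    moreover have "t powr (\<beta> - 1) = t powr (\<alpha> - 1) * t powr (\<beta> - \<alpha>)"
      by (simp flip: powr_add)
    ultimately show ?thesis by (simp add: mult_ac)
  qed
  then have "J \<le> \<tau> powr (\<beta> - \<alpha>) * I" by (rule has_mellin_mono[OF has_mellin_J has_mellin_I(1)])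
  also have "\<dots> \<le> 0" using has_mellin_I(2) by (simp add: mult_nonneg_nonpos)
  finally show ?thesis .
qed

section \<open>Log-concave functions\<close>

lemma powr_mult_powr_eq_exp:
  "0 < p \<Longrightarrow> 0 < q \<Longrightarrow> p powr (1 - l) * q powr l = exp ((1 - l) * ln p + l * ln q)" for p q l :: real
  by (simp add: powr_def exp_add)

lemma log_concave_nonneg: "log_concave f \<Longrightarrow> 0 \<le> f x"
  by (simp add: log_concave_def)

lemma log_concave_powr_le:
  assumes log_concave: "log_concave f" and weight: "0 < l" "l < 1"
  shows "f x powr (1 - l) * f y powr l \<le> f ((1 - l) *\<^sub>R x + l *\<^sub>R y)"
proof (cases "0 < f x \<and> 0 < f y")
  case True
  then have "0 < f ((1 - l) *\<^sub>R x + l *\<^sub>R y)"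
    using log_concave weight convexD_alt[of "{x. 0 < f x}" x y l] by (simp add: log_concave_def)
  moreover have "(1 - l) * ln (f x) + l * ln (f y) \<le> ln (f ((1 - l) *\<^sub>R x + l *\<^sub>R y))"
    using log_concave weight True by (intro concave_onD) (auto simp: log_concave_def)
  ultimately show ?thesis using True by (simp add: powr_mult_powr_eq_exp ln_ge_iff)
next
  case False
  then have "f x = 0 \<or> f y = 0"
    using log_concave_nonneg[OF log_concave, of x] log_concave_nonneg[OF log_concave, of y] by linarith
  then show ?thesis using log_concave_nonneg[OF log_concave] by auto
qed

lemma log_concaveI:
  assumes nonneg: "\<And>x. 0 \<le> f x"
    and geometric: "\<And>x y l. 0 < l \<Longrightarrow> l < 1 \<Longrightarrow> f x powr (1 - l) * f y powr l \<le> f ((1 - l) *\<^sub>R x + l *\<^sub>R y)"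
  shows "log_concave f"
  unfolding log_concave_def concave_on_def
proof (intro conjI allI nonneg)
  have pos: "0 < f ((1 - l) *\<^sub>R x + l *\<^sub>R y)" if "0 < f x" "0 < f y" "0 < l" "l < 1" for x y l
  proof -
    have "0 < f x powr (1 - l) * f y powr l" using that by simp
    also have "\<dots> \<le> f ((1 - l) *\<^sub>R x + l *\<^sub>R y)" using that by (intro geometric)
    finally show ?thesis .
  qed
  show convex: "convex {x. 0 < f x}"
    unfolding convex_alt
  proof (intro ballI allI impI)
    fix x y and l :: real
    assume endpoints: "x \<in> {x. 0 < f x}" "y \<in> {x. 0 < f x}" "0 \<le> l \<and> l \<le> 1"
    then consider "l = 0" | "l = 1" | "0 < l" "l < 1" by linarith
    then show "(1 - l) *\<^sub>R x + l *\<^sub>R y \<in> {x. 0 < f x}" using endpoints by cases (auto intro: pos)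
  qed
  show "convex_on {x. 0 < f x} (\<lambda>x. - ln (f x))"
  proof (rule convex_onI[OF _ convex])
    fix l :: real and x y assume weight: "0 < l" "l < 1" and "x \<in> {x. 0 < f x}" "y \<in> {x. 0 < f x}"
    then have support: "0 < f x" "0 < f y" by auto
    have "exp ((1 - l) * ln (f x) + l * ln (f y)) \<le> f ((1 - l) *\<^sub>R x + l *\<^sub>R y)"
      using geometric[OF weight] by (simp flip: powr_mult_powr_eq_exp[OF support])
    then have "(1 - l) * ln (f x) + l * ln (f y) \<le> ln (f ((1 - l) *\<^sub>R x + l *\<^sub>R y))"
      using pos[OF support weight] by (simp add: ln_ge_iff)
    then show "- ln (f ((1 - l) *\<^sub>R x + l *\<^sub>R y)) \<le> (1 - l) * - ln (f x) + l * - ln (f y)" by simp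
  qed
qed

lemma log_concave_compose_linear:
  assumes "log_concave f" "linear T"
  shows "log_concave (\<lambda>x. f (T x))"
  using assms
  by (intro log_concaveI) (simp_all add: log_concave_nonneg log_concave_powr_le linear_add linear_cmul)

lemma log_concave_divide:
  assumes log_concave: "log_concave f" and c_pos: "0 < c"
  shows "log_concave (\<lambda>x. f x / c)"
proof (rule log_concaveI)
  show "0 \<le> f x / c" for x using log_concave_nonneg[OF log_concave] c_pos by simp
  fix x y and l :: real assume weight: "0 < l" "l < 1"
  have "(f x / c) powr (1 - l) * (f y / c) powr l = f x powr (1 - l) * f y powr l / c"
    using c_pos by (simp add: powr_divide flip: powr_add)
  then show "(f x / c) powr (1 - l) * (f y / c) powr l \<le> f ((1 - l) *\<^sub>R x + l *\<^sub>R y) / c"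
    using log_concave_powr_le[OF log_concave weight] c_pos by (simp add: divide_right_mono)
qed

section \<open>Mean radii of log-concave profiles\<close>

text \<open>In terms of \<open>g t = covar f (t *\<^sub>R \<xi>) / l2sq f\<close> this is the radial function of \<open>R\<^sub>\<alpha> f\<close> in
  direction \<open>\<xi>\<close>, divided by \<open>gamma_factor \<alpha>\<close>.\<close>

definition normalized_mean_radius :: "real \<Rightarrow> (real \<Rightarrow> real) \<Rightarrow> real" where
  "normalized_mean_radius \<alpha> g =
    (if \<alpha> = 0 then exp (mellin (\<lambda>t. g t - exp (- t)) 0)
     else (mellin (\<lambda>t. g t - (if \<alpha> < 0 then 1 else 0)) \<alpha> / Gamma \<alpha>) powr (1 / \<alpha>))"

lemma normalized_mean_radius_cong:
  "(\<And>t. 0 < t \<Longrightarrow> g t = h t) \<Longrightarrow> normalized_mean_radius \<alpha> g = normalized_mean_radius \<alpha> h"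
  unfolding normalized_mean_radius_def by (simp cong: mellin_cong)

lemma powr_minus_powr_inverse: "0 < k \<Longrightarrow> \<alpha> \<noteq> 0 \<Longrightarrow> (k powr - \<alpha>) powr (1 / \<alpha>) = 1 / k" for k \<alpha> :: real
  using powr_minus_divide[of k 1] by (simp add: powr_powr)

lemma powr_inverse_le_iff:
  fixes x y \<alpha> :: real
  assumes "0 < x" "0 < y" "\<alpha> \<noteq> 0"
  shows "x powr (1 / \<alpha>) \<le> y powr (1 / \<alpha>) \<longleftrightarrow> (x - y) / \<alpha> \<le> 0"
  using assms by (cases "0 < \<alpha>") (auto simp: powr_def divide_le_cancel divide_le_0_iff)

lemma normalized_mean_radius_exp:
  assumes k_pos: "0 < k" and exponent: "-1 < \<alpha>"
  shows "normalized_mean_radius \<alpha> (\<lambda>t. exp (- (k * t))) = 1 / k"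
proof (cases "\<alpha> = 0")
  case True
  have "mellin (\<lambda>t. exp (- (k * t)) - exp (- t)) 0 = - ln k"
    using mellin_eqI[OF has_mellin_frullani_exp[OF k_pos, of 1]] by simp
  then show ?thesis using True k_pos by (simp add: normalized_mean_radius_def exp_minus divide_inverse)
next
  case False
  then have "Gamma \<alpha> \<noteq> 0" using exponent Gamma_real_pos[of "\<alpha> + 1"] by (auto simp: Gamma_plus1_real)
  then show ?thesis
    using False k_pos exponent mellin_eqI[OF has_mellin_exp_regularized[OF exponent False k_pos]]
    by (simp add: normalized_mean_radius_def powr_minus_powr_inverse)
qed

locale log_concave_profile =
  fixes g :: "real \<Rightarrow> real"
  assumes log_concave: "log_concave g"
    and one_at_0: "g 0 = 1"
    and le_one: "0 \<le> t \<Longrightarrow> g t \<le> 1"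
    and pos: "\<exists>t>0. 0 < g t"
    and less_one: "\<exists>t>0. g t < 1"
begin

lemma nonneg: "0 \<le> g t"
  using log_concave by (rule log_concave_nonneg)

lemma powr_le:
  assumes "0 < s" "s \<le> t"
  shows "g t powr (s / t) \<le> g s"
proof (cases "s = t")
  case False
  then have "g 0 powr (1 - s / t) * g t powr (s / t) \<le> g ((1 - s / t) *\<^sub>R 0 + (s / t) *\<^sub>R t)"
    using assms by (intro log_concave_powr_le log_concave) auto
  then show ?thesis using one_at_0 assms by simp
qed (use assms nonneg in simp)

lemma antimono:
  assumes "0 < s" "s \<le> t"
  shows "g t \<le> g s"
proof -
  have "g t = g t powr 1" using nonneg by simp
  also have "\<dots> \<le> g t powr (s / t)"
    using assms nonneg le_one[of t] by (intro powr_mono') auto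
  also have "\<dots> \<le> g s" using assms by (rule powr_le)
  finally show ?thesis .
qed

lemma one_minus_le_linear: "\<exists>A\<ge>0. \<forall>t>0. 1 - g t \<le> A * t"
proof -
  obtain t0 where t0_pos: "0 < t0" "0 < g t0" using pos by blast
  define c where "c = 1 - ln (g t0)"
  have c_ge_1: "1 \<le> c" using t0_pos le_one[of t0] by (simp add: c_def)
  have "1 - g t \<le> c / t0 * t" if t_pos: "0 < t" for t
  proof (cases "t \<le> t0")
    case True
    have "1 + t / t0 * ln (g t0) \<le> exp (t / t0 * ln (g t0))" by (rule exp_ge_add_one_self)
    also have "\<dots> = g t0 powr (t / t0)" using t0_pos by (simp add: powr_def)
    also have "\<dots> \<le> g t" using t_pos True by (rule powr_le)
    finally have "1 - g t \<le> - ln (g t0) * (t / t0)" by (simp add: algebra_simps)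
    also have "\<dots> \<le> c * (t / t0)" using t_pos t0_pos by (intro mult_right_mono) (auto simp: c_def)
    finally show ?thesis by simp
  next
    case False
    have "1 - g t \<le> 1" using nonneg by simp
    also have "1 \<le> c * (t / t0)" using mult_mono[of 1 c 1 "t / t0"] False t0_pos c_ge_1 by simp
    finally show ?thesis by simp
  qed
  moreover have "0 \<le> c / t0" using c_ge_1 t0_pos by simp
  ultimately show ?thesis by blast
qed

lemma le_exponential: "\<exists>B b. 0 \<le> B \<and> 0 < b \<and> (\<forall>t>0. g t \<le> B * exp (- (b * t)))"
proof -
  obtain t1 where t1_less_one: "0 < t1" "g t1 < 1" using less_one by blast
  define q where "q = max (g t1) (1 / 2)"
  have q_bounds: "0 < q" "q < 1" "g t1 \<le> q" using t1_less_one by (auto simp: q_def)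
  define b where "b = - ln q / t1"
  have b_rate: "0 < b" "exp (- (b * t)) = q powr (t / t1)" for t
    using q_bounds t1_less_one by (auto simp: b_def powr_def field_simps)
  have "g t \<le> exp (b * t1) * exp (- (b * t))" if t_pos: "0 < t" for t
  proof (cases "t \<le> t1")
    case True
    have "g t \<le> 1" using le_one t_pos by simp
    also have "1 \<le> exp (b * t1 + - (b * t))" using True b_rate(1) by simp
    finally show ?thesis by (simp add: exp_add[symmetric])
  next
    case False
    have "g t powr (t1 / t) \<le> q" using powr_le[of t1 t] t1_less_one q_bounds False by simp
    then have "(g t powr (t1 / t)) powr (t / t1) \<le> q powr (t / t1)"
      using t_pos t1_less_one by (intro powr_mono2) auto
    then have "g t \<le> exp (- (b * t))"
      using t_pos t1_less_one nonneg[of t] by (simp add: powr_powr b_rate(2))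
    also have "\<dots> \<le> exp (b * t1) * exp (- (b * t))" using b_rate(1) t1_less_one by simp
    finally show ?thesis .
  qed
  then show ?thesis using b_rate(1) exp_ge_zero by blast
qed

lemma diff_indicator_bound:
  "\<exists>C b. 0 < b \<and> (\<forall>t>0. \<bar>g t - indicator {..1} t\<bar> \<le> C * (t * exp (- (b * t))))"
proof -
  obtain A where linear_bound: "0 \<le> A" "\<And>t. 0 < t \<Longrightarrow> 1 - g t \<le> A * t" using one_minus_le_linear by blast
  obtain B b where exp_bound: "0 \<le> B" "0 < b" "\<And>t. 0 < t \<Longrightarrow> g t \<le> B * exp (- (b * t))"
    using le_exponential by blast
  have "\<bar>g t - indicator {..1} t\<bar> \<le> (A * exp b + B) * (t * exp (- (b * t)))" if t_pos: "0 < t" for t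
  proof (cases "t \<le> 1")
    case True
    have "\<bar>g t - indicator {..1} t\<bar> \<le> A * t * 1"
      using True linear_bound(2)[OF t_pos] le_one[of t] t_pos by simp
    also have "\<dots> \<le> A * t * exp (b + - (b * t))"
      using linear_bound t_pos exp_bound True by (intro mult_left_mono) auto
    also have "\<dots> = A * exp b * (t * exp (- (b * t)))" unfolding exp_add by (simp only: mult_ac)
    also have "\<dots> \<le> (A * exp b + B) * (t * exp (- (b * t)))"
      using exp_bound t_pos by (intro mult_right_mono) auto
    finally show ?thesis .
  next
    case False
    have "\<bar>g t - indicator {..1} t\<bar> \<le> B * (1 * exp (- (b * t)))"
      using False exp_bound(3)[OF t_pos] nonneg by simp
    also have "\<dots> \<le> B * (t * exp (- (b * t)))"
      using exp_bound False by (intro mult_left_mono mult_right_mono) auto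
    also have "\<dots> \<le> (A * exp b + B) * (t * exp (- (b * t)))"
      using linear_bound t_pos by (intro mult_right_mono) auto
    finally show ?thesis .
  qed
  then show ?thesis using exp_bound(2) by blast
qed

lemma set_borel_measurable_profile: "set_borel_measurable lborel {0<..} g"
proof -
  have "mono_on {0<..} (\<lambda>t. - g t)" by (intro mono_onI) (auto intro: antimono)
  then have "(\<lambda>t. - g t) \<in> borel_measurable (restrict_space borel {0<..})"
    by (rule borel_measurable_mono_on_fnc)
  then have "g \<in> borel_measurable (restrict_space borel {0<..})" by simp
  then show ?thesis
    unfolding set_borel_measurable_def by (subst (asm) borel_measurable_restrict_space_iff) auto
qed

lemma mellin_integrable_diff_indicator:
  assumes exponent: "-1 < \<alpha>"
  shows "mellin_integrable (\<lambda>t. g t - indicator {..1} t) \<alpha>"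
proof -
  obtain C b where b_pos: "0 < b"
    and bound: "\<And>t. 0 < t \<Longrightarrow> \<bar>g t - indicator {..1} t\<bar> \<le> C * (t * exp (- (b * t)))"
    using diff_indicator_bound by blast
  have "has_mellin (\<lambda>t. exp (- (b * t))) (\<alpha> + 1) (Gamma (\<alpha> + 1) * b powr - (\<alpha> + 1))"
    using exponent b_pos by (intro has_mellin_exp) auto
  from has_bochner_integral_mult_right[OF this[unfolded has_mellin_def], of C]
  have "has_mellin (\<lambda>t. C * (t * exp (- (b * t)))) \<alpha> (C * (Gamma (\<alpha> + 1) * b powr - (\<alpha> + 1)))"
    unfolding has_mellin_def
    by (rule has_bochner_integral_cong[THEN iffD1, rotated -1]) (auto simp: indicator_def powr_diff)
  moreover have "set_borel_measurable lborel {0<..} (\<lambda>t. g t - indicator {..1} t)"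
    using set_borel_measurable_profile unfolding set_borel_measurable_def scaleR_diff_right
    by (rule borel_measurable_diff) simp
  ultimately show ?thesis by (rule mellin_integrable_bound) (rule bound)
qed

end

lemma log_concave_profile_exp:
  assumes "0 < k"
  shows "log_concave_profile (\<lambda>t. exp (- (k * t)))"
proof
  show "log_concave (\<lambda>t. exp (- (k * t)))"
    by (rule log_concaveI) (simp_all add: exp_powr_real algebra_simps flip: exp_add)
  show "\<exists>t>0. exp (- (k * t)) < 1" using assms by (intro exI[of _ 1]) simp
qed (use assms in \<open>auto intro: gt_ex\<close>)

context log_concave_profile
begin

lemma mellin_integrable_diff_exp:
  assumes k_pos: "0 < k" and exponent: "-1 < \<alpha>"
  shows "mellin_integrable (\<lambda>t. g t - exp (- (k * t))) \<alpha>"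
proof -
  interpret exp: log_concave_profile "\<lambda>t. exp (- (k * t))"
    by (rule log_concave_profile_exp[OF k_pos])
  show ?thesis
    using has_mellin_imp_mellin_integrable[OF has_mellin_diff
      [OF mellin_integrable_diff_indicator exp.mellin_integrable_diff_indicator]] exponent
    by simp
qed

lemma has_mellin_regularized:
  assumes exponent: "-1 < \<alpha>" "\<alpha> \<noteq> 0" and k_pos: "0 < k"
  shows "has_mellin (\<lambda>t. g t - (if \<alpha> < 0 then 1 else 0)) \<alpha>
    (mellin (\<lambda>t. g t - exp (- (k * t))) \<alpha> + Gamma \<alpha> * k powr - \<alpha>)"
  using has_mellin_add
    [OF mellin_integrable_diff_exp[OF k_pos exponent(1)] has_mellin_exp_regularized[OF exponent k_pos]]
  by simp

lemma mellin_regularized_div_Gamma_pos: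
  assumes exponent: "-1 < \<alpha>" "\<alpha> \<noteq> 0"
  shows "0 < mellin (\<lambda>t. g t - (if \<alpha> < 0 then 1 else 0)) \<alpha> / Gamma \<alpha>"
proof (cases "0 < \<alpha>")
  case True
  obtain t0 where t0_pos: "0 < t0" "0 < g t0" using pos by blast
  have "mellin_integrable g \<alpha>"
    using has_mellin_imp_mellin_integrable[OF has_mellin_regularized[OF exponent zero_less_one]] True
    by simp
  then have "0 < mellin g \<alpha>"
  proof (rule has_mellin_pos[OF _ nonneg order_refl t0_pos(1)])
    show "0 < g t" if "0 < t" "t < t0" for t using antimono[of t t0] that t0_pos by simp
  qed
  then show ?thesis using True Gamma_real_pos by simp
next
  case False
  obtain t1 where t1_less_one: "0 < t1" "g t1 < 1" using less_one by blast
  have "mellin_integrable (\<lambda>t. g t - 1) \<alpha>"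
    using has_mellin_imp_mellin_integrable[OF has_mellin_regularized[OF exponent zero_less_one]]
      False exponent
    by simp
  from has_mellin_minus[OF this] have "has_mellin (\<lambda>t. 1 - g t) \<alpha> (- mellin (\<lambda>t. g t - 1) \<alpha>)" by simp
  then have "0 < - mellin (\<lambda>t. g t - 1) \<alpha>"
  proof (rule has_mellin_pos[where a = t1 and b = "t1 + 1"])
    show "0 < 1 - g t" if "t1 < t" for t using antimono[of t1 t] that t1_less_one by simp
  qed (use t1_less_one le_one in auto)
  moreover have "Gamma \<alpha> < 0"
    using Gamma_real_pos[of "\<alpha> + 1"] exponent False by (simp add: Gamma_plus1_real zero_less_mult_iff)
  ultimately show ?thesis using False exponent by (simp add: divide_neg_neg)
qed

lemma normalized_mean_radius_pos: "-1 < \<alpha> \<Longrightarrow> 0 < normalized_mean_radius \<alpha> g"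
  using mellin_regularized_div_Gamma_pos[of \<alpha>] by (auto simp: normalized_mean_radius_def)

lemma normalized_mean_radius_le_iff:
  assumes k_pos: "0 < k" and exponent: "-1 < \<alpha>"
  shows "normalized_mean_radius \<alpha> g \<le> 1 / k \<longleftrightarrow> mellin (\<lambda>t. g t - exp (- (k * t))) \<alpha> \<le> 0"
    (is "_ \<longleftrightarrow> ?D \<le> 0")
proof (cases "\<alpha> = 0")
  case True
  have "has_mellin (\<lambda>t. (g t - exp (- (k * t))) + (exp (- (k * t)) - exp (- (1 * t)))) 0
      (?D + (ln 1 - ln k))"
    using mellin_integrable_diff_exp[OF k_pos exponent]
      has_mellin_frullani_exp[OF k_pos zero_less_one] True
    by (intro has_mellin_add) simp_all
  then have "mellin (\<lambda>t. g t - exp (- t)) 0 = ?D - ln k" by (simp add: mellin_eqI)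
  then have "normalized_mean_radius \<alpha> g = exp ?D / k"
    using True k_pos by (simp add: normalized_mean_radius_def exp_diff)
  then show ?thesis using k_pos by (simp add: divide_le_cancel)
next
  case False
  define y where "y = mellin (\<lambda>t. g t - (if \<alpha> < 0 then 1 else 0)) \<alpha> / Gamma \<alpha>"
  have Gamma_pos: "0 < \<alpha> * Gamma \<alpha>"
    using Gamma_real_pos[of "\<alpha> + 1"] exponent False by (simp add: Gamma_plus1_real)
  have y_pos: "0 < y" unfolding y_def using exponent False by (rule mellin_regularized_div_Gamma_pos)
  have "y - k powr - \<alpha> = ?D / Gamma \<alpha>"
    using mellin_eqI[OF has_mellin_regularized[OF exponent False k_pos]] Gamma_pos
    by (auto simp: y_def add_divide_distrib)
  then have diff_eq: "(y - k powr - \<alpha>) / \<alpha> = ?D / (\<alpha> * Gamma \<alpha>)" by simp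
  have "normalized_mean_radius \<alpha> g \<le> 1 / k \<longleftrightarrow> y powr (1 / \<alpha>) \<le> (k powr - \<alpha>) powr (1 / \<alpha>)"
    using False k_pos by (simp add: normalized_mean_radius_def y_def powr_minus_powr_inverse)
  also have "\<dots> \<longleftrightarrow> ?D / (\<alpha> * Gamma \<alpha>) \<le> 0"
    using y_pos k_pos False by (simp add: powr_inverse_le_iff diff_eq)
  also have "\<dots> \<longleftrightarrow> ?D \<le> 0" using Gamma_pos by (simp only: divide_le_0_iff) auto
  finally show ?thesis .
qed

lemma diff_exp_nonneg_downward:
  assumes "0 < s" "s \<le> t" "0 \<le> g t - exp (- (k * t))"
  shows "0 \<le> g s - exp (- (k * s))"
proof -
  have "exp (- (k * s)) = exp (- (k * t)) powr (s / t)"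
    using assms by (simp add: powr_def)
  also have "\<dots> \<le> g t powr (s / t)" using assms by (intro powr_mono2) auto
  also have "\<dots> \<le> g s" using assms by (intro powr_le) auto
  finally show ?thesis by simp
qed

theorem normalized_mean_radius_antimono:
  assumes exponents: "-1 < \<alpha>" "\<alpha> < \<beta>"
  shows "normalized_mean_radius \<beta> g \<le> normalized_mean_radius \<alpha> g"
proof -
  define k where "k = 1 / normalized_mean_radius \<alpha> g"
  have k_pos: "0 < k" using normalized_mean_radius_pos[OF exponents(1)] by (simp add: k_def)
  have "mellin (\<lambda>t. g t - exp (- (k * t))) \<alpha> \<le> 0"
    using normalized_mean_radius_le_iff[OF k_pos exponents(1)] by (simp add: k_def)
  then have "mellin (\<lambda>t. g t - exp (- (k * t))) \<beta> \<le> 0"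
  proof (rule has_mellin_single_crossing
      [OF exponents(2) mellin_integrable_diff_exp[OF k_pos exponents(1)]])
    show "mellin_integrable (\<lambda>t. g t - exp (- (k * t))) \<beta>"
      using exponents by (intro mellin_integrable_diff_exp k_pos) simp
  qed (rule diff_exp_nonneg_downward)
  then show ?thesis
    using normalized_mean_radius_le_iff[OF k_pos, of \<beta>] exponents by (simp add: k_def)
qed

end

section \<open>The covariogram\<close>

lemma
  fixes y :: "'a::euclidean_space"
  shows measurable_lebesgue_translate: "(\<lambda>x. x + y) \<in> lebesgue \<rightarrow>\<^sub>M lebesgue"
    and distr_lebesgue_translate: "distr lebesgue lebesgue (\<lambda>x. x + y) = lebesgue"
  using lebesgue_affine_measurable[of "\<lambda>_::'a. 1" y] lebesgue_affine_euclidean[of "\<lambda>_::'a. 1" y]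
  by (simp_all add: euclidean_representation density_1 add.commute)

lemma borel_measurable_lebesgue_translate:
  fixes f :: "'a::euclidean_space \<Rightarrow> 'b::topological_space"
  assumes "f \<in> borel_measurable lebesgue"
  shows "(\<lambda>x. f (x + y)) \<in> borel_measurable lebesgue"
  using measurable_compose[OF measurable_lebesgue_translate assms] .

lemma integral_lebesgue_translate:
  fixes f :: "'a::euclidean_space \<Rightarrow> real"
  assumes "f \<in> borel_measurable lebesgue"
  shows "(LINT x|lebesgue. f (x + y)) = (LINT x|lebesgue. f x)"
  using integral_distr[OF measurable_lebesgue_translate assms, of y]
  by (simp add: distr_lebesgue_translate)

lemma integrable_lebesgue_translate:
  fixes f :: "'a::euclidean_space \<Rightarrow> real"
  assumes "integrable lebesgue f"
  shows "integrable lebesgue (\<lambda>x. f (x + y))"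
  by (rule integrable_distr[OF measurable_lebesgue_translate])
    (simp add: distr_lebesgue_translate assms)

lemma tendsto_integral_halfspace:
  fixes h :: "'a::euclidean_space \<Rightarrow> real"
  assumes integrable_h: "integrable lebesgue h" and q_pos: "0 < q"
  shows "(\<lambda>n. LINT x:{x. v \<bullet> x \<le> real n * q}|lebesgue. h x) \<longlonglongrightarrow> (LINT x|lebesgue. h x)"
    and "(\<lambda>n. LINT x:{x. v \<bullet> x \<le> - (real n * q)}|lebesgue. h x) \<longlonglongrightarrow> 0"
proof -
  have archimedean: "\<exists>n. s \<le> real n * q" for s
    using real_arch_simple[of "s / q"] q_pos by (simp add: pos_divide_le_eq)
  have halfspace_sets: "{x. v \<bullet> x \<le> s} \<in> sets lebesgue" for s
    using borel_closed[OF closed_halfspace_le[of v s]] by simp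
  have integrable_on: "set_integrable lebesgue A h" if "A \<in> sets lebesgue" for A
    using integrable_mult_indicator[OF that integrable_h] by (simp add: set_integrable_def)
  have "(\<lambda>n. LINT x:{x. v \<bullet> x \<le> real n * q}|lebesgue. h x)
      \<longlonglongrightarrow> (LINT x:(\<Union>n. {x. v \<bullet> x \<le> real n * q})|lebesgue. h x)"
    using q_pos halfspace_sets by (intro set_integral_cont_up integrable_on)
      (auto simp: incseq_def intro: order_trans mult_right_mono)
  moreover have "(\<Union>n. {x. v \<bullet> x \<le> real n * q}) = UNIV"
    using archimedean by auto
  ultimately show "(\<lambda>n. LINT x:{x. v \<bullet> x \<le> real n * q}|lebesgue. h x) \<longlonglongrightarrow> (LINT x|lebesgue. h x)"
    by (simp add: set_lebesgue_integral_def)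
  have "(\<lambda>n. LINT x:{x. v \<bullet> x \<le> - (real n * q)}|lebesgue. h x)
      \<longlonglongrightarrow> (LINT x:(\<Inter>n. {x. v \<bullet> x \<le> - (real n * q)})|lebesgue. h x)"
    using q_pos halfspace_sets by (intro set_integral_cont_down integrable_on)
      (auto simp: decseq_def intro: order_trans mult_right_mono)
  moreover have "(\<Inter>n. {x. v \<bullet> x \<le> - (real n * q)}) = {}"
  proof -
    have "\<exists>n. \<not> v \<bullet> x \<le> - (real n * q)" for x
    proof -
      obtain n where "1 - v \<bullet> x \<le> real n * q" using archimedean by blast
      then have "\<not> v \<bullet> x \<le> - (real n * q)" by linarith
      then show ?thesis by blast
    qed
    then show ?thesis by blast
  qed
  ultimately show "(\<lambda>n. LINT x:{x. v \<bullet> x \<le> - (real n * q)}|lebesgue. h x) \<longlonglongrightarrow> 0"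
    by (simp add: set_lebesgue_integral_def)
qed

text \<open>The integral over the half-space \<open>{x. v \<bullet> x \<le> s}\<close> is \<open>(v \<bullet> v)\<close>-periodic in \<open>s\<close>, while it tends
  to \<open>0\<close> and to the full integral as \<open>s\<close> tends to \<open>-\<infinity>\<close> and \<open>\<infinity>\<close>.\<close>

lemma integral_eq_0_if_AE_translation_invariant:
  fixes h :: "'a::euclidean_space \<Rightarrow> real"
  assumes integrable_h: "integrable lebesgue h" and v_nonzero: "v \<noteq> 0"
    and invariant: "AE x in lebesgue. h (x + v) = h x"
  shows "(LINT x|lebesgue. h x) = 0"
proof -
  define H where "H s = {x. v \<bullet> x \<le> s}" for s
  define q where "q = v \<bullet> v"
  have [measurable]: "H s \<in> sets lebesgue" for s
    unfolding H_def using borel_closed[OF closed_halfspace_le[of v s]] by simp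
  have [measurable]: "h \<in> borel_measurable lebesgue" "(\<lambda>x. h (x + v)) \<in> borel_measurable lebesgue"
    using integrable_h borel_measurable_lebesgue_translate by auto
  have periodic: "(LINT x:H (s + q)|lebesgue. h x) = (LINT x:H s|lebesgue. h x)" for s
  proof -
    have "indicator (H (s + q)) (x + v) = (indicator (H s) x :: real)" for x
      by (simp add: H_def q_def inner_add_right indicator_def)
    then have "(LINT x:H (s + q)|lebesgue. h x) = (LINT x|lebesgue. indicator (H s) x *\<^sub>R h (x + v))"
      using integral_lebesgue_translate[of "\<lambda>x. indicator (H (s + q)) x *\<^sub>R h x" v]
      by (simp add: set_lebesgue_integral_def)
    also have "\<dots> = (LINT x:H s|lebesgue. h x)"
      unfolding set_lebesgue_integral_def using invariant by (intro integral_cong_AE) auto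
    finally show ?thesis .
  qed
  have "(LINT x:H (real n * q)|lebesgue. h x) = (LINT x:H 0|lebesgue. h x)" for n
    using periodic[of "real m * q" for m] by (induction n) (simp_all add: algebra_simps)
  moreover have "(LINT x:H (- (real n * q))|lebesgue. h x) = (LINT x:H 0|lebesgue. h x)" for n
    using periodic[of "- (real (Suc m) * q)" for m] by (induction n) (simp_all add: algebra_simps)
  moreover have "0 < q" using v_nonzero by (simp add: q_def)
  ultimately show ?thesis
    using tendsto_integral_halfspace[OF integrable_h, of q v]
    by (simp add: LIMSEQ_const_iff flip: H_def)
qed

context
  fixes f :: "'a::euclidean_space \<Rightarrow> real"
  assumes in_L2: "in_L2 f"
begin

lemma in_L2_measurable: "f \<in> borel_measurable lebesgue"
  and in_L2_integrable_square: "integrable lebesgue (\<lambda>x. (f x)\<^sup>2)"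
  using in_L2 by (auto simp: in_L2_def)

lemma integral_translate_square: "(LINT x|lebesgue. (f (x + y))\<^sup>2) = l2sq f"
  unfolding l2sq_def using in_L2_measurable
  by (intro integral_lebesgue_translate[where f="\<lambda>x. (f x)\<^sup>2"]) simp

lemma integrable_covar: "integrable lebesgue (\<lambda>x. f x * f (x + y))"
proof (rule Bochner_Integration.integrable_bound)
  show "integrable lebesgue (\<lambda>x. (f x)\<^sup>2 + (f (x + y))\<^sup>2)"
    using in_L2_integrable_square integrable_lebesgue_translate[OF in_L2_integrable_square]
    by (rule Bochner_Integration.integrable_add)
  show "(\<lambda>x. f x * f (x + y)) \<in> borel_measurable lebesgue"
    using in_L2_measurable borel_measurable_lebesgue_translate[OF in_L2_measurable]
    by (rule borel_measurable_times)
  have "\<bar>p * q\<bar> \<le> p\<^sup>2 + q\<^sup>2" for p q :: real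
  proof -
    have "2 * \<bar>p * q\<bar> \<le> p\<^sup>2 + q\<^sup>2"
      using sum_squares_bound[of "\<bar>p\<bar>" "\<bar>q\<bar>"] by (simp add: abs_mult mult.assoc)
    then show ?thesis by linarith
  qed
  then show "AE x in lebesgue. norm (f x * f (x + y)) \<le> norm ((f x)\<^sup>2 + (f (x + y))\<^sup>2)"
    by simp
qed

lemma has_bochner_integral_diff_translate_square:
  "has_bochner_integral lebesgue (\<lambda>x. (f (x + y) - f x)\<^sup>2) (2 * (l2sq f - covar f y))"
proof -
  have "has_bochner_integral lebesgue (\<lambda>x. (f (x + y))\<^sup>2 + (f x)\<^sup>2 - 2 * (f x * f (x + y)))
      (l2sq f + l2sq f - 2 * covar f y)"
  proof (intro has_bochner_integral_diff has_bochner_integral_add has_bochner_integral_mult_right)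
    show "has_bochner_integral lebesgue (\<lambda>x. (f (x + y))\<^sup>2) (l2sq f)"
      using integrable_lebesgue_translate[OF in_L2_integrable_square] integral_translate_square
      by (simp add: has_bochner_integral_iff)
  qed (simp_all add: has_bochner_integral_iff in_L2_integrable_square integrable_covar covar_def l2sq_def)
  then show ?thesis by (simp add: power2_diff mult_ac)
qed

lemma covar_le_l2sq: "covar f y \<le> l2sq f"
proof -
  have "0 \<le> (LINT x|lebesgue. (f (x + y) - f x)\<^sup>2)" by simp
  then show ?thesis
    by (simp add: has_bochner_integral_integral_eq[OF has_bochner_integral_diff_translate_square])
qed

lemma covar_less_l2sq:
  assumes nonzero: "l2sq f \<noteq> 0" and y_nonzero: "y \<noteq> 0"
  shows "covar f y < l2sq f"
proof (rule ccontr)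
  assume "\<not> covar f y < l2sq f"
  then have "covar f y = l2sq f" using covar_le_l2sq[of y] by simp
  then have "integrable lebesgue (\<lambda>x. (f (x + y) - f x)\<^sup>2)" "(LINT x|lebesgue. (f (x + y) - f x)\<^sup>2) = 0"
    using has_bochner_integral_diff_translate_square[of y] by (auto simp: has_bochner_integral_iff)
  then have "AE x in lebesgue. (f (x + y) - f x)\<^sup>2 = 0"
    by (simp add: integral_nonneg_eq_0_iff_AE)
  then have "AE x in lebesgue. (f (x + y))\<^sup>2 = (f x)\<^sup>2" by eventually_elim simp
  then have "(LINT x|lebesgue. (f x)\<^sup>2) = 0"
    by (rule integral_eq_0_if_AE_translation_invariant[OF in_L2_integrable_square y_nonzero])
  then show False using nonzero by (simp add: l2sq_def)
qed

lemma normalized_radial_mean_rho_eq: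
  assumes nonzero: "l2sq f \<noteq> 0" and exponent: "-1 < \<alpha>"
  shows "radial_mean_rho \<alpha> f \<xi> / gamma_factor \<alpha>
    = normalized_mean_radius \<alpha> (\<lambda>t. covar f (t *\<^sub>R \<xi>) / l2sq f)"
proof -
  let ?g = "\<lambda>t. covar f (t *\<^sub>R \<xi>) / l2sq f"
  consider (zero) "\<alpha> = 0" | (positive) "0 < \<alpha>" | (negative) "\<alpha> < 0" by linarith
  then show ?thesis
  proof cases
    case zero
    have "mellin (\<lambda>t. ?g t - exp (- t)) 0 = (LINT t:{0<..}|lborel. (1 / t) * (?g t - exp (- t)))"
      unfolding mellin_def by (intro set_lebesgue_integral_cong) (auto simp: powr_minus divide_inverse)
    with zero show ?thesis
      by (simp add: radial_mean_rho_def gamma_factor_def normalized_mean_radius_def flip: exp_diff)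
  next
    case positive
    have "\<alpha> / l2sq f * (LINT t:{0<..}|lborel. t powr (\<alpha> - 1) * covar f (t *\<^sub>R \<xi>)) = \<alpha> * mellin ?g \<alpha>"
      by (simp add: mellin_def set_lebesgue_integral_def)
    with positive exponent show ?thesis
      by (simp add: radial_mean_rho_def gamma_factor_def normalized_mean_radius_def Gamma_plus1_real
          flip: powr_divide)
  next
    case negative
    have "t powr (\<alpha> - 1) * (LINT x|lebesgue. (f (x + t *\<^sub>R \<xi>) - f x)\<^sup>2)
        = - (2 * l2sq f) * (t powr (\<alpha> - 1) * (?g t - 1))" for t
      using nonzero
      by (simp add: field_simps
          has_bochner_integral_integral_eq[OF has_bochner_integral_diff_translate_square])
    then have "(LINT t:{0<..}|lborel. t powr (\<alpha> - 1) * (LINT x|lebesgue. (f (x + t *\<^sub>R \<xi>) - f x)\<^sup>2))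
        = - (2 * l2sq f) * mellin (\<lambda>t. ?g t - 1) \<alpha>"
      by (simp only: set_integral_mult_right mellin_def)
    then have "\<bar>\<alpha>\<bar> / (2 * l2sq f) * (LINT t:{0<..}|lborel. t powr (\<alpha> - 1)
        * (LINT x|lebesgue. (f (x + t *\<^sub>R \<xi>) - f x)\<^sup>2)) = \<alpha> * mellin (\<lambda>t. ?g t - 1) \<alpha>"
      using negative nonzero by simp
    with negative exponent show ?thesis
      by (simp add: radial_mean_rho_def gamma_factor_def normalized_mean_radius_def Gamma_plus1_real
          flip: powr_divide)
  qed
qed

end

lemma log_concave_interior_support_nonempty:
  assumes log_concave: "log_concave f" and nonzero: "l2sq f \<noteq> 0"
  shows "interior {x. 0 < f x} \<noteq> {}"
proof
  assume "interior {x. 0 < f x} = {}"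
  then have "negligible {x. 0 < f x}"
    using log_concave negligible_convex_interior[of "{x. 0 < f x}"] by (simp add: log_concave_def)
  then have "AE x in lebesgue. x \<notin> {x. 0 < f x}"
    unfolding negligible_iff_null_sets by (rule AE_not_in)
  then have "AE x in lebesgue. (f x)\<^sup>2 = 0"
    by eventually_elim (use log_concave_nonneg[OF log_concave] in \<open>auto simp: not_less intro: antisym\<close>)
  then show False using nonzero unfolding l2sq_def by (simp add: integral_eq_zero_AE)
qed

context
  fixes f :: "'a::euclidean_space \<Rightarrow> real"
  assumes in_L2: "in_L2 f" and log_concave: "log_concave f"
begin

lemma log_concave_covar: "log_concave (covar f)"
proof (rule log_concaveI)
  note nonneg = log_concave_nonneg[OF log_concave]
  show "0 \<le> covar f y" for y unfolding covar_def by (simp add: nonneg)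
  fix y z and l :: real assume weight: "0 < l" "l < 1"
  have "(f u * f (u + y)) powr (1 - l) * (f v * f (v + z)) powr l
      \<le> f ((1 - l) *\<^sub>R u + l *\<^sub>R v) * f ((1 - l) *\<^sub>R u + l *\<^sub>R v + ((1 - l) *\<^sub>R y + l *\<^sub>R z))" for u v
  proof -
    have "(f u * f (u + y)) powr (1 - l) * (f v * f (v + z)) powr l
        = (f u powr (1 - l) * f v powr l) * (f (u + y) powr (1 - l) * f (v + z) powr l)"
      by (simp add: powr_mult mult_ac)
    also have "\<dots> \<le> f ((1 - l) *\<^sub>R u + l *\<^sub>R v) * f ((1 - l) *\<^sub>R (u + y) + l *\<^sub>R (v + z))"
      by (intro mult_mono log_concave_powr_le[OF log_concave weight] nonneg) simp
    also have "(1 - l) *\<^sub>R (u + y) + l *\<^sub>R (v + z)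
        = (1 - l) *\<^sub>R u + l *\<^sub>R v + ((1 - l) *\<^sub>R y + l *\<^sub>R z)"
      by (simp add: scaleR_right_distrib)
    finally show ?thesis .
  qed
  then show "covar f y powr (1 - l) * covar f z powr l \<le> covar f ((1 - l) *\<^sub>R y + l *\<^sub>R z)"
    unfolding covar_def
    by (intro prekopa_leindler[OF weight] integrable_covar[OF in_L2]) (simp_all add: nonneg)
qed

lemma covar_pos_near_0:
  assumes nonzero: "l2sq f \<noteq> 0"
  obtains r where "0 < r" "\<And>y. norm y < r \<Longrightarrow> 0 < covar f y"
proof -
  obtain c where "c \<in> interior {x. 0 < f x}"
    using log_concave_interior_support_nonempty[OF log_concave nonzero] by auto
  then obtain r where support_ball: "0 < r" "ball c r \<subseteq> {x. 0 < f x}" by (auto simp: mem_interior)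
  have "0 < covar f y" if norm_y: "norm y < r / 2" for y
    unfolding covar_def
  proof (rule integral_pos_if_pos_on[OF integrable_covar[OF in_L2]])
    show "AE x in lebesgue. 0 \<le> f x * f (x + y)" using log_concave_nonneg[OF log_concave] by simp
    show "ball c (r / 2) \<in> sets lebesgue" by (simp add: fmeasurableD)
    show "emeasure lebesgue (ball c (r / 2)) \<noteq> 0"
      using open_not_negligible[of "ball c (r / 2)"] support_ball(1)
      by (auto simp: negligible_iff_emeasure0 fmeasurableD)
    show "0 < f x * f (x + y)" if dist_x: "x \<in> ball c (r / 2)" for x
    proof -
      have "dist c (x + y) \<le> dist c x + norm y"
        by (metis add_diff_cancel_left' dist_commute dist_norm dist_triangle)
      then have "x \<in> ball c r" "x + y \<in> ball c r" using dist_x norm_y support_ball by auto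
      then show ?thesis using support_ball(2) by (intro mult_pos_pos) auto
    qed
  qed
  then show ?thesis using that[of "r / 2"] support_ball(1) by simp
qed

lemma log_concave_profile_covar:
  assumes nonzero: "l2sq f \<noteq> 0" and direction: "\<xi> \<noteq> 0"
  shows "log_concave_profile (\<lambda>t. covar f (t *\<^sub>R \<xi>) / l2sq f)"
proof
  have pos: "0 < l2sq f" using nonzero unfolding l2sq_def by (simp add: less_le)
  show "log_concave (\<lambda>t. covar f (t *\<^sub>R \<xi>) / l2sq f)"
    using pos by (intro log_concave_divide log_concave_compose_linear[OF log_concave_covar])
      (simp_all add: linear_scaleR_left)
  show "covar f (0 *\<^sub>R \<xi>) / l2sq f = 1"
    using nonzero by (simp add: covar_def l2sq_def power2_eq_square)
  show "covar f (t *\<^sub>R \<xi>) / l2sq f \<le> 1" for t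
    using covar_le_l2sq[OF in_L2] pos by simp
  obtain r where "0 < r" "\<And>y. norm y < r \<Longrightarrow> 0 < covar f y"
    using covar_pos_near_0[OF nonzero] by blast
  then show "\<exists>t>0. 0 < covar f (t *\<^sub>R \<xi>) / l2sq f"
    using pos direction by (intro exI[of _ "r / (2 * norm \<xi>)"]) simp
  show "\<exists>t>0. covar f (t *\<^sub>R \<xi>) / l2sq f < 1"
    using covar_less_l2sq[OF in_L2 nonzero, of "1 *\<^sub>R \<xi>"] pos direction by (intro exI[of _ 1]) simp
qed

end

section \<open>Simplex exponentials\<close>

definition exp_ray :: "real \<Rightarrow> real" where
  "exp_ray s = (if 0 \<le> s then exp (- s) else 0)"

lemma exp_ray_nonneg: "0 \<le> exp_ray s"
  by (simp add: exp_ray_def)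

lemma exp_ray_pos: "0 \<le> s \<Longrightarrow> 0 < exp_ray s"
  by (simp add: exp_ray_def)

lemma exp_ray_le: "exp_ray s \<le> exp (- \<bar>s\<bar>)"
  by (simp add: exp_ray_def)

lemma borel_measurable_exp_ray [measurable]: "exp_ray \<in> borel_measurable borel"
  unfolding exp_ray_def by measurable

lemma exp_ray_mult_translate:
  "exp_ray s * exp_ray (s + u) = exp (- \<bar>u\<bar>) * (exp_ray (s - max 0 (- u)))\<^sup>2"
  by (auto simp: exp_ray_def max_def power2_eq_square simp flip: exp_add)

lemma integrable_exp_neg_abs:
  assumes q_pos: "0 < q"
  shows "integrable lborel (\<lambda>s::real. exp (- (q * \<bar>s\<bar>)))"
proof -
  define half where "half s = indicator {0<..} s * (s powr (1 - 1) * exp (- (q * s)))" for s :: real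
  have integrable_half: "integrable lborel half"
    using has_mellin_exp[of 1 q] q_pos
    by (simp add: half_def[abs_def] has_mellin_def has_bochner_integral_iff)
  then have "integrable lborel (\<lambda>s. half (0 + (- 1) * s))"
    by (rule lborel_integrable_real_affine) simp
  with integrable_half have "integrable lborel (\<lambda>s. half s + half (- s))" by simp
  then show ?thesis
  proof (rule integrable_cong_AE_imp)
    show "AE s in lborel. half s + half (- s) = exp (- (q * \<bar>s\<bar>))"
      by (rule AE_mp[OF AE_lborel_singleton[of "0::real"]], rule AE_I2)
         (auto simp: half_def indicator_def)
  qed simp
qed

lemma integrable_exp_neg_norm:
  assumes q_pos: "0 < q"
  shows "integrable lborel (\<lambda>x::'a::euclidean_space. exp (- (q * norm x)))"
proof (rule integrableI_bounded)
  define p where "p = q / DIM('a)"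
  have p_pos: "0 < p" using q_pos by (simp add: p_def)
  have le_prod: "exp (- (q * norm x)) \<le> (\<Prod>b\<in>Basis. exp (- (p * \<bar>x \<bullet> b\<bar>)))" for x :: 'a
  proof -
    have "(\<Sum>b\<in>Basis. p * \<bar>x \<bullet> b\<bar>) \<le> (\<Sum>b\<in>(Basis :: 'a set). p * norm x)"
      using p_pos by (intro sum_mono mult_left_mono Basis_le_norm) auto
    also have "\<dots> = q * norm x" by (simp add: p_def)
    finally show ?thesis by (simp add: exp_sum[symmetric] sum_negf)
  qed
  have "(\<integral>\<^sup>+x. ennreal (norm (exp (- (q * norm (x :: 'a))))) \<partial>lborel)
      \<le> (\<integral>\<^sup>+x. (\<Prod>b\<in>(Basis :: 'a set). ennreal (exp (- (p * \<bar>x \<bullet> b\<bar>)))) \<partial>lborel)"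
    using le_prod by (intro nn_integral_mono) (simp add: prod_ennreal ennreal_leI)
  also have "\<dots> = (\<Prod>b\<in>(Basis :: 'a set). \<integral>\<^sup>+s. ennreal (exp (- (p * \<bar>s\<bar>))) \<partial>lborel)"
    by (rule nn_integral_lborel_prod) auto
  also have "\<dots> < \<infinity>"
    using integrable_exp_neg_abs[OF p_pos] by (simp add: integrable_iff_bounded power_less_top_ennreal)
  finally show "(\<integral>\<^sup>+x. ennreal (norm (exp (- (q * norm (x :: 'a))))) \<partial>lborel) < \<infinity>" .
qed simp

locale spanning_independent =
  fixes B :: "'a::euclidean_space set"
  assumes independent_B: "independent B" and span_B: "span B = UNIV"
begin

abbreviation coord :: "'a \<Rightarrow> 'a \<Rightarrow> real" where "coord x b \<equiv> representation B x b"

lemma finite_B: "finite B"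
  using independent_B by (rule independent_imp_finite)

lemma sum_coord: "(\<Sum>b\<in>B. coord x b *\<^sub>R b) = x"
  using independent_B span_B finite_B by (intro real_vector.sum_representation_eq) auto

lemma linear_coord: "linear (\<lambda>x. coord x b)"
  using real_vector.representation_add[OF independent_B]
    real_vector.representation_scale[OF independent_B] span_B
  by (intro linearI) simp_all

lemmas coord_add = linear_add[OF linear_coord]
  and coord_diff = linear_diff[OF linear_coord]
  and coord_scale = linear_cmul[OF linear_coord]

lemma coord_sum:
  assumes "b \<in> B"
  shows "coord (\<Sum>c\<in>B. u c *\<^sub>R c) b = u b"
proof -
  have "coord (\<Sum>c\<in>B. u c *\<^sub>R c) b = (\<Sum>c\<in>B. if c = b then u c else 0)"
    unfolding linear_sum[OF linear_coord]
    by (intro sum.cong) (auto simp: coord_scale real_vector.representation_basis[OF independent_B])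
  then show ?thesis using assms finite_B by simp
qed

lemma continuous_on_coord [continuous_intros]:
  "continuous_on S h \<Longrightarrow> continuous_on S (\<lambda>x. coord (h x) b)"
  using linear_coord unfolding linear_conv_bounded_linear by (rule bounded_linear.continuous_on)

lemma norm_le_sum_abs_coord: "\<exists>K>0. \<forall>x. norm x \<le> K * (\<Sum>b\<in>B. \<bar>coord x b\<bar>)"
proof -
  define K where "K = 1 + (\<Sum>b\<in>B. norm b)"
  have K_pos: "0 < K" by (simp add: K_def add_pos_nonneg sum_nonneg)
  have norm_le: "norm b \<le> K" if "b \<in> B" for b
    using member_le_sum[of b B norm] that finite_B by (simp add: K_def)
  have "norm x \<le> K * (\<Sum>b\<in>B. \<bar>coord x b\<bar>)" for x
  proof -
    have "norm x = norm (\<Sum>b\<in>B. coord x b *\<^sub>R b)" by (simp only: sum_coord)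
    also have "\<dots> \<le> (\<Sum>b\<in>B. \<bar>coord x b\<bar> * K)"
      using norm_le by (intro order_trans[OF norm_sum] sum_mono) (simp add: mult_left_mono)
    finally show ?thesis by (simp add: sum_distrib_left mult.commute)
  qed
  with K_pos show ?thesis by blast
qed

lemma mem_simplex_iff:
  "x \<in> convex hull (insert 0 B) \<longleftrightarrow> (\<forall>b\<in>B. 0 \<le> coord x b) \<and> (\<Sum>b\<in>B. coord x b) \<le> 1"
proof -
  have "0 \<notin> B" using independent_B dependent_zero by blast
  then have hull: "convex hull (insert 0 B)
      = {y. \<exists>u. (\<forall>b\<in>B. 0 \<le> u b) \<and> sum u B \<le> 1 \<and> (\<Sum>b\<in>B. u b *\<^sub>R b) = y}"
    by (rule Starlike.simplex[OF finite_B])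
  show ?thesis
  proof
    assume "x \<in> convex hull (insert 0 B)"
    then obtain u where "\<forall>b\<in>B. 0 \<le> u b" "sum u B \<le> 1" "x = (\<Sum>b\<in>B. u b *\<^sub>R b)"
      unfolding hull by auto
    then show "(\<forall>b\<in>B. 0 \<le> coord x b) \<and> (\<Sum>b\<in>B. coord x b) \<le> 1"
      by (simp add: coord_sum)
  next
    assume "(\<forall>b\<in>B. 0 \<le> coord x b) \<and> (\<Sum>b\<in>B. coord x b) \<le> 1"
    then show "x \<in> convex hull (insert 0 B)"
      unfolding hull using sum_coord[of x] by blast
  qed
qed

lemma mem_scaled_simplex_iff:
  assumes r_pos: "0 < r"
  shows "x \<in> (\<lambda>y. r *\<^sub>R y) ` (convex hull (insert 0 B))
    \<longleftrightarrow> (\<forall>b\<in>B. 0 \<le> coord x b) \<and> (\<Sum>b\<in>B. coord x b) \<le> r"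
proof -
  have "x \<in> (\<lambda>y. r *\<^sub>R y) ` (convex hull (insert 0 B)) \<longleftrightarrow> (1 / r) *\<^sub>R x \<in> convex hull (insert 0 B)"
    using r_pos by (force intro: image_eqI[of _ _ "(1 / r) *\<^sub>R x"])
  also have "\<dots> \<longleftrightarrow> (\<forall>b\<in>B. 0 \<le> coord x b) \<and> (\<Sum>b\<in>B. coord x b) \<le> r"
    using r_pos by (simp add: mem_simplex_iff coord_scale zero_le_divide_iff flip: sum_divide_distrib)
  finally show ?thesis .
qed

lemma gauge_simplex:
  "gauge (convex hull (insert 0 B)) x = (if \<forall>b\<in>B. 0 \<le> coord x b then ereal (\<Sum>b\<in>B. coord x b) else \<infinity>)"
proof (cases "\<forall>b\<in>B. 0 \<le> coord x b")
  case True
  define s where "s = (\<Sum>b\<in>B. coord x b)"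
  have s_nonneg: "0 \<le> s" using True by (auto simp: s_def intro: sum_nonneg)
  have "{ereal r | r. r > 0 \<and> x \<in> (\<lambda>y. r *\<^sub>R y) ` (convex hull (insert 0 B))}
      = {ereal r | r. r > 0 \<and> s \<le> r}"
    using True mem_scaled_simplex_iff[of _ x] unfolding s_def by blast
  moreover have "Inf {ereal r | r. r > 0 \<and> s \<le> r} = ereal s"
  proof (rule antisym)
    have "Inf {ereal r | r. r > 0 \<and> s \<le> r} \<le> ereal s + ereal e" if "0 < e" for e
      using s_nonneg that by (intro Inf_lower) auto
    then show "Inf {ereal r | r. r > 0 \<and> s \<le> r} \<le> ereal s"
      by (rule ereal_le_epsilon2)
    show "ereal s \<le> Inf {ereal r | r. r > 0 \<and> s \<le> r}"
      by (intro Inf_greatest) auto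
  qed
  ultimately show ?thesis using True by (simp add: gauge_def s_def)
next
  case False
  then have empty: "{ereal r | r. r > 0 \<and> x \<in> (\<lambda>y. r *\<^sub>R y) ` (convex hull (insert 0 B))} = {}"
    using mem_scaled_simplex_iff[of _ x] by blast
  show ?thesis unfolding gauge_def empty if_not_P[OF False] by (simp add: top_ereal_def)
qed

lemma simplex_exp_eq_prod:
  "simplex_exp a x0 (convex hull (insert 0 B)) x = a * (\<Prod>b\<in>B. exp_ray (coord (x - x0) b))"
proof (cases "\<forall>b\<in>B. 0 \<le> coord (x - x0) b")
  case True
  then have "(\<Prod>b\<in>B. exp_ray (coord (x - x0) b)) = exp (- (\<Sum>b\<in>B. coord (x - x0) b))"
    using finite_B by (simp add: exp_ray_def exp_sum flip: sum_negf)
  then show ?thesis using True by (simp add: simplex_exp_def gauge_simplex)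
next
  case False
  then have "(\<Prod>b\<in>B. exp_ray (coord (x - x0) b)) = 0"
    using finite_B by (auto simp: exp_ray_def)
  then show ?thesis unfolding simplex_exp_def gauge_simplex if_not_P[OF False] by simp
qed

lemma borel_measurable_simplex_exp:
  "simplex_exp a x0 (convex hull (insert 0 B)) \<in> borel_measurable borel"
proof -
  have [measurable]: "(\<lambda>x. coord (x - x0) b) \<in> borel_measurable borel" for b
    by (intro borel_measurable_continuous_onI continuous_intros)
  show ?thesis unfolding simplex_exp_eq_prod[abs_def] by measurable
qed

context
  fixes a :: real and x0 :: 'a
  assumes a_pos: "0 < a"
begin

abbreviation f :: "'a \<Rightarrow> real" where
  "f \<equiv> simplex_exp a x0 (convex hull (insert 0 B))"

lemma simplex_exp_nonneg: "0 \<le> f x"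
  using a_pos by (simp add: simplex_exp_eq_prod prod_nonneg exp_ray_nonneg)

lemma in_L2_simplex_exp: "in_L2 f"
proof -
  obtain K where K_bound: "0 < K" "\<And>x. norm x \<le> K * (\<Sum>b\<in>B. \<bar>coord x b\<bar>)"
    using norm_le_sum_abs_coord by blast
  have bound: "f x \<le> a * exp (- (1 / K * norm (x - x0)))" for x
  proof -
    have "(\<Prod>b\<in>B. exp_ray (coord (x - x0) b)) \<le> (\<Prod>b\<in>B. exp (- \<bar>coord (x - x0) b\<bar>))"
      by (intro prod_mono conjI exp_ray_nonneg exp_ray_le)
    also have "\<dots> = exp (- (\<Sum>b\<in>B. \<bar>coord (x - x0) b\<bar>))"
      using finite_B by (simp add: exp_sum flip: sum_negf)
    also have "\<dots> \<le> exp (- (1 / K * norm (x - x0)))"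
      using K_bound by (simp add: pos_divide_le_eq mult.commute)
    finally show ?thesis using a_pos by (simp add: simplex_exp_eq_prod mult_left_mono)
  qed
  have measurable: "f \<in> borel_measurable lebesgue"
    using borel_measurable_simplex_exp by (simp add: measurable_completion)
  have square_bound: "(f x)\<^sup>2 \<le> a\<^sup>2 * exp (- (2 / K * norm (x - x0)))" for x
    using power_mono[OF bound simplex_exp_nonneg, of x 2]
    by (simp add: power_mult_distrib exp_double[symmetric])
  have "integrable lebesgue (\<lambda>x::'a. exp (- (2 / K * norm x)))"
    using integrable_exp_neg_norm[of "2 / K"] K_bound(1) by (subst integrable_completion) auto
  from integrable_lebesgue_translate[OF this, of "- x0"]
  have "integrable lebesgue (\<lambda>x. a\<^sup>2 * exp (- (2 / K * norm (x - x0))))" by simp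
  then have "integrable lebesgue (\<lambda>x. (f x)\<^sup>2)"
    by (rule Bochner_Integration.integrable_bound) (use measurable square_bound in auto)
  then show ?thesis using measurable by (simp add: in_L2_def)
qed

lemma l2sq_simplex_exp_pos: "0 < l2sq f"
  unfolding l2sq_def
proof (rule integral_pos_if_pos_on)
  define U where "U = (\<Inter>b\<in>B. {x. 0 < coord (x - x0) b})"
  have "open U"
    unfolding U_def using finite_B by (intro open_INT ballI open_Collect_less continuous_intros) auto
  moreover have "x0 + (\<Sum>b\<in>B. 1 *\<^sub>R b) \<in> U"
    unfolding U_def by (auto simp: coord_sum[of _ "\<lambda>_. 1", simplified])
  ultimately show "U \<in> sets lebesgue" "emeasure lebesgue U \<noteq> 0"
    using open_not_negligible[of U] by (auto simp: negligible_iff_emeasure0)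
  show "0 < (f x)\<^sup>2" if "x \<in> U" for x
  proof -
    have "0 < (\<Prod>b\<in>B. exp_ray (coord (x - x0) b))"
      using that by (intro prod_pos) (auto simp: U_def intro: exp_ray_pos less_imp_le)
    then show ?thesis using a_pos by (simp add: simplex_exp_eq_prod)
  qed
  show "integrable lebesgue (\<lambda>x. (f x)\<^sup>2)" using in_L2_simplex_exp by (simp add: in_L2_def)
qed simp

text \<open>With \<open>m\<close> the negative part of \<open>y\<close> in the basis \<open>B\<close>, the supports of \<open>f\<close> and of its translate
  meet in the support of \<open>f\<close> translated by \<open>m\<close>.\<close>

lemma covar_simplex_exp: "covar f y = exp (- (\<Sum>b\<in>B. \<bar>coord y b\<bar>)) * l2sq f"
proof -
  define m where "m = (\<Sum>b\<in>B. max 0 (- coord y b) *\<^sub>R b)"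
  have "f x * f (x + y) = exp (- (\<Sum>b\<in>B. \<bar>coord y b\<bar>)) * (f (x + - m))\<^sup>2" for x
  proof -
    define z where "z = coord (x - x0)"
    have "f x * f (x + y) = a\<^sup>2 * (\<Prod>b\<in>B. exp_ray (z b) * exp_ray (z b + coord y b))"
      by (simp add: simplex_exp_eq_prod z_def power2_eq_square prod.distrib algebra_simps
          flip: coord_add)
    also have "\<dots> = a\<^sup>2 * ((\<Prod>b\<in>B. exp (- \<bar>coord y b\<bar>)) * (\<Prod>b\<in>B. exp_ray (z b - max 0 (- coord y b)))\<^sup>2)"
      by (simp add: exp_ray_mult_translate prod.distrib prod_power_distrib)
    also have "(\<Prod>b\<in>B. exp_ray (z b - max 0 (- coord y b))) = (\<Prod>b\<in>B. exp_ray (coord (x + - m - x0) b))"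
      by (intro prod.cong arg_cong[of _ _ exp_ray])
        (simp_all add: z_def m_def coord_sum coord_diff coord_add)
    also have "(\<Prod>b\<in>B. exp (- \<bar>coord y b\<bar>)) = exp (- (\<Sum>b\<in>B. \<bar>coord y b\<bar>))"
      using finite_B by (simp add: exp_sum flip: sum_negf)
    finally show ?thesis by (simp add: simplex_exp_eq_prod power_mult_distrib)
  qed
  then show ?thesis
    unfolding covar_def using integral_translate_square[OF in_L2_simplex_exp, of "- m"] by simp
qed

lemma normalized_radial_mean_simplex_exp:
  assumes direction: "\<xi> \<noteq> 0" and exponent: "-1 < \<alpha>"
  shows "radial_mean_rho \<alpha> f \<xi> / gamma_factor \<alpha> = 1 / (\<Sum>b\<in>B. \<bar>coord \<xi> b\<bar>)"
proof -
  define k where "k = (\<Sum>b\<in>B. \<bar>coord \<xi> b\<bar>)"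
  have "k \<noteq> 0"
  proof
    assume "k = 0"
    then have "\<forall>b\<in>B. coord \<xi> b = 0" using finite_B by (simp add: k_def sum_nonneg_eq_0_iff)
    then show False using sum_coord[of \<xi>] direction by simp
  qed
  then have k_pos: "0 < k" by (simp add: k_def less_le sum_nonneg)
  have "covar f (t *\<^sub>R \<xi>) / l2sq f = exp (- (k * t))" if "0 < t" for t
    using that l2sq_simplex_exp_pos
    by (simp add: covar_simplex_exp coord_scale abs_mult k_def sum_distrib_left[symmetric] mult.commute)
  then have "radial_mean_rho \<alpha> f \<xi> / gamma_factor \<alpha> = normalized_mean_radius \<alpha> (\<lambda>t. exp (- (k * t)))"
    using normalized_radial_mean_rho_eq[OF in_L2_simplex_exp _ exponent] l2sq_simplex_exp_pos
    by (simp cong: normalized_mean_radius_cong)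
  then show ?thesis using normalized_mean_radius_exp[OF k_pos exponent] by (simp add: k_def)
qed

end

end

lemma full_simplex_vertex0_obtain_basis:
  fixes \<Delta> :: "'a::euclidean_space set"
  assumes "full_simplex_vertex0 \<Delta>"
  obtains B where "spanning_independent B" "\<Delta> = convex hull (insert 0 B)"
proof -
  obtain C where vertices: "\<not> affine_dependent C" "card C = DIM('a) + 1" "0 \<in> C" "\<Delta> = convex hull C"
    using assms by (auto simp: full_simplex_vertex0_def)
  define B where "B = C - {0}"
  have "independent B"
    using vertices(1) affine_dependent_iff_dependent2[OF vertices(3)] by (simp add: B_def)
  moreover have "card B = DIM('a)"
    using vertices(2,3) by (simp add: B_def)
  ultimately have "span B = UNIV"
    using card_ge_dim_independent[of B UNIV] by (simp add: top.extremum_unique)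
  then have "spanning_independent B" using \<open>independent B\<close> by unfold_locales
  moreover have "insert 0 B = C" using vertices(3) by (auto simp: B_def)
  ultimately show ?thesis using that vertices(4) by blast
qed

theorem theorem19:
  fixes dummy :: "'a::euclidean_space"
  shows "(\<forall>f :: 'a \<Rightarrow> real. in_L2 f \<and> l2sq f \<noteq> 0 \<and> log_concave f \<longrightarrow>
           (\<forall>\<alpha> \<beta>. -1 < \<alpha> \<and> \<alpha> < \<beta> \<longrightarrow>
              (\<forall>\<xi>. norm \<xi> = 1 \<longrightarrow>
                 radial_mean_rho \<beta> f \<xi> / gamma_factor \<beta> \<le> radial_mean_rho \<alpha> f \<xi> / gamma_factor \<alpha>)))
       \<and> (\<forall>a (x0 :: 'a) \<Delta>. 0 < a \<and> full_simplex_vertex0 \<Delta> \<longrightarrow>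
           (\<forall>\<alpha> \<beta>. -1 < \<alpha> \<and> \<alpha> < \<beta> \<longrightarrow>
              (\<forall>\<xi>. norm \<xi> = 1 \<longrightarrow>
                 radial_mean_rho \<beta> (simplex_exp a x0 \<Delta>) \<xi> / gamma_factor \<beta>
                 = radial_mean_rho \<alpha> (simplex_exp a x0 \<Delta>) \<xi> / gamma_factor \<alpha>)))"
proof (intro conjI allI impI)
  fix f :: "'a \<Rightarrow> real" and \<alpha> \<beta> :: real and \<xi> :: 'a
  assume admissible: "in_L2 f \<and> l2sq f \<noteq> 0 \<and> log_concave f" and exponents: "-1 < \<alpha> \<and> \<alpha> < \<beta>"
    and unit: "norm \<xi> = 1"
  interpret log_concave_profile "\<lambda>t. covar f (t *\<^sub>R \<xi>) / l2sq f"
    using admissible unit by (intro log_concave_profile_covar) auto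
  show "radial_mean_rho \<beta> f \<xi> / gamma_factor \<beta> \<le> radial_mean_rho \<alpha> f \<xi> / gamma_factor \<alpha>"
    using normalized_mean_radius_antimono[of \<alpha> \<beta>] exponents admissible
    by (simp add: normalized_radial_mean_rho_eq)
next
  fix a :: real and x0 :: 'a and \<Delta> :: "'a set" and \<alpha> \<beta> :: real and \<xi> :: 'a
  assume simplex: "0 < a \<and> full_simplex_vertex0 \<Delta>" and exponents: "-1 < \<alpha> \<and> \<alpha> < \<beta>"
    and unit: "norm \<xi> = 1"
  obtain B where basis: "spanning_independent B" and hull: "\<Delta> = convex hull (insert 0 B)"
    using simplex full_simplex_vertex0_obtain_basis by blast
  interpret spanning_independent B by (rule basis)
  have "\<xi> \<noteq> 0" using unit by auto
  then show "radial_mean_rho \<beta> (simplex_exp a x0 \<Delta>) \<xi> / gamma_factor \<beta>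
      = radial_mean_rho \<alpha> (simplex_exp a x0 \<Delta>) \<xi> / gamma_factor \<alpha>"
    unfolding hull using simplex exponents by (simp add: normalized_radial_mean_simplex_exp)
qed

end
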